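(* Let $\rho>0$, $r_0\ge 0$ and $\beta-\alpha>\pi/\rho$. Let $\mathcal{B}$ be a subalgebra of the algebra $\mathcal{A}=\mathcal{A}_{\alpha,\beta,r_0,\rho}$. Suppose that $p$ is a holomorphic function on $S(\alpha,\beta,r_0)$ and that there are a monic polynomial $P\in\mathcal{B}[w]$ of degree $m\ge 1$ and a function $f$ holomorphic on $S(\alpha,\beta,r_0)$ such that $P(f)=e^p$. If $e^p$ has almost sinusoidal indicator of order $\rho$, then $P(w)=(w+q)^m$ for some $q\in\mathcal{B}$, and $f=\varepsilon e^{p/m}-q$ for some constant $\varepsilon\in\mathbb{C}$ with $\varepsilon^m=1$.
   Context: For $\alpha<\beta$ and $r_0\ge0$, $S(\alpha,\beta,r_0)=\{z=re^{i\theta}: r>r_0,\ \alpha<\theta<\beta\}$. A holomorphic function $f$ on $S(\alpha,\beta,r_0)$ is of order at most $\rho\ge0$ if for every $\rho'>\rho$ there is a constant $C(\rho')$ such that $|f(z)|\le C(\rho')e^{|z|^{\rho'}}$ on $S(\alpha,\beta,r_0)$. For $\alpha<\theta<\beta$, the indicator of $f$ of order $\rho$ is $h_{f,\rho}(\theta)=\limsup_{r\to\infty}\frac{\log|f(re^{i\theta})|}{r^\rho}$ (possibly infinite). $\mathcal{A}_{\alpha,\beta,r_0,\rho}$ is the algebra of all functions $f$ holomorphic on $S(\alpha,\beta,r_0)$ that are of order at most $\rho$ and satisfy $h_{f,\rho}(\theta)\le 0$ for all $\alpha<\theta<\beta$. $\mathcal{B}[w]$ is the algebra of polynomials in $w$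 with coefficients in $\mathcal{B}$; a monic polynomial $P(w)=w^m+P_{m-1}w^{m-1}+\dots+P_0$ has $P_j\in\mathcal{B}$, and $P(f)=f^m+P_{m-1}f^{m-1}+\dots+P_0$. For $p$ holomorphic on $S(\alpha,\beta,r_0)$, the indicator of order $\rho>0$ of $e^p$ is called almost sinusoidal if $e^p$ and $e^{-p}$ are of order at most $\rho$, and there is a (nonempty open) interval $(\alpha_1,\beta_1)\subset(\alpha,\beta)$ such that $h_{e^{-p},\rho}(\theta)<0$ for $\theta\in(\alpha_1,\beta_1)$ while $h_{e^p,\rho}(\theta)\le0$ for all remaining $\theta\in(\alpha,\beta)$. *)

theory Defs
  imports "HOL-Complex_Analysis.Complex_Analysis" "HOL-Library.Function_Algebras"
begin

text \<open>Functions on a sector are total functions \<open>complex \<Rightarrow> complex\<close> of which only the values on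
  the sector are meaningful. Equations between such functions are therefore stated on the sector
  only. The pointwise ring structure is the one of \<open>Function_Algebras\<close>, so that polynomials whose
  coefficients are functions are elements of \<open>(complex \<Rightarrow> complex) poly\<close>.\<close>

text \<open>The sector is a subset of the complex plane, also when \<open>\<beta> - \<alpha> > 2 * pi\<close>; it is then
  the whole complement of the closed disc of radius \<open>r0\<close>.\<close>

definition sector :: "real \<Rightarrow> real \<Rightarrow> real \<Rightarrow> complex set" where
  "sector \<alpha> \<beta> r0 = {z. \<exists>r \<theta>. r > r0 \<and> \<alpha> < \<theta> \<and> \<theta> < \<beta> \<and> z = rcis r \<theta>}"

definition order_at_most :: "complex set \<Rightarrow> real \<Rightarrow> (complex \<Rightarrow> complex) \<Rightarrow> bool" where
  "order_at_most S \<rho> f \<longleftrightarrow>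
     f holomorphic_on S \<and> (\<forall>\<rho>'>\<rho>. \<exists>C. \<forall>z\<in>S. norm (f z) \<le> C * exp (norm z powr \<rho>'))"

text \<open>\<open>log_norm w\<close> is \<open>log \<bar>w\<bar>\<close> with the value \<open>-\<infinity>\<close> at zero (whereas \<open>ln 0 = 0\<close>).\<close>

definition log_norm :: "complex \<Rightarrow> ereal" where
  "log_norm w = (if w = 0 then -\<infinity> else ereal (ln (norm w)))"

definition ray_indicator :: "real \<Rightarrow> (complex \<Rightarrow> complex) \<Rightarrow> real \<Rightarrow> ereal" where
  "ray_indicator \<rho> f \<theta> = Limsup at_top (\<lambda>r. log_norm (f (rcis r \<theta>)) / ereal (r powr \<rho>))"

definition sector_algebra :: "real \<Rightarrow> real \<Rightarrow> real \<Rightarrow> real \<Rightarrow> (complex \<Rightarrow> complex) set" where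
  "sector_algebra \<alpha> \<beta> r0 \<rho> =
     {f. order_at_most (sector \<alpha> \<beta> r0) \<rho> f \<and> (\<forall>\<theta>\<in>{\<alpha><..<\<beta>}. ray_indicator \<rho> f \<theta> \<le> 0)}"

text \<open>Subalgebras are not required to contain the constant function \<open>1\<close>.\<close>

definition subalgebra_of :: "(complex \<Rightarrow> complex) set \<Rightarrow> (complex \<Rightarrow> complex) set \<Rightarrow> bool" where
  "subalgebra_of B A \<longleftrightarrow> B \<subseteq> A \<and> 0 \<in> B \<and> (\<forall>f\<in>B. \<forall>g\<in>B. f + g \<in> B) \<and>
     (\<forall>f\<in>B. \<forall>g\<in>B. f * g \<in> B) \<and> (\<forall>c. \<forall>f\<in>B. (\<lambda>z. c * f z) \<in> B)"

text \<open>The leading coefficient \<open>1\<close> is exempted from the membership condition, which matters only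
  if \<open>B\<close> does not contain \<open>1\<close>.\<close>

definition monic_over :: "(complex \<Rightarrow> complex) set \<Rightarrow> nat \<Rightarrow> (complex \<Rightarrow> complex) poly \<Rightarrow> bool" where
  "monic_over B m P \<longleftrightarrow> degree P = m \<and> lead_coeff P = 1 \<and> (\<forall>j<m. coeff P j \<in> B)"

definition poly_eq_on ::
    "complex set \<Rightarrow> (complex \<Rightarrow> complex) poly \<Rightarrow> (complex \<Rightarrow> complex) poly \<Rightarrow> bool" where
  "poly_eq_on S P Q \<longleftrightarrow> (\<forall>j. \<forall>z\<in>S. coeff P j z = coeff Q j z)"

definition almost_sinusoidal ::
    "real \<Rightarrow> real \<Rightarrow> real \<Rightarrow> real \<Rightarrow> (complex \<Rightarrow> complex) \<Rightarrow> bool" where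
  "almost_sinusoidal \<alpha> \<beta> r0 \<rho> p \<longleftrightarrow>
     order_at_most (sector \<alpha> \<beta> r0) \<rho> (\<lambda>z. exp (p z)) \<and>
     order_at_most (sector \<alpha> \<beta> r0) \<rho> (\<lambda>z. exp (- p z)) \<and>
     (\<exists>\<alpha>1 \<beta>1. \<alpha>1 < \<beta>1 \<and> {\<alpha>1<..<\<beta>1} \<subseteq> {\<alpha><..<\<beta>} \<and>
        (\<forall>\<theta>\<in>{\<alpha>1<..<\<beta>1}. ray_indicator \<rho> (\<lambda>z. exp (- p z)) \<theta> < 0) \<and>
        (\<forall>\<theta>\<in>{\<alpha><..<\<beta>} - {\<alpha>1<..<\<beta>1}. ray_indicator \<rho> (\<lambda>z. exp (p z)) \<theta> \<le> 0))"

end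

theory Submission imports Defs "HOL-Real_Asymp.Real_Asymp" begin

text \<open>Put \<open>E = e\<^sup>p\<^sup>/\<^sup>m\<close>. On the rays where \<open>E\<close> is large, \<open>u = f / E\<close> satisfies
  \<open>u\<^sup>m - 1 = - (\<Sum>j<m. P\<^sub>j E\<^sup>j\<^sup>-\<^sup>m u\<^sup>j)\<close>, whose right-hand side is exponentially small; by continuity \<open>u\<close> follows
  a single root of unity \<open>\<epsilon>\<close>, and \<open>h = f - \<epsilon> E\<close> has indicator \<open>\<le> 0\<close>. On the other rays \<open>e\<^sup>p\<close>, hence \<open>f\<close>
  and \<open>E\<close>, have indicator \<open>\<le> 0\<close>. So all coefficients of the polynomial \<open>P(h + W) - W\<^sup>m\<close> in \<open>W\<close> have
  indicator \<open>\<le> 0\<close>, while \<open>W = \<epsilon> E\<close> is a root of it. Its highest nonzero coefficient would decay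
  exponentially on a ray, which is impossible in a sector of opening larger than \<open>\<pi> / \<rho>\<close>, by a
  Phragmen-Lindelof argument. Hence \<open>P(h + W) = W\<^sup>m\<close>, that is \<open>P(w) = (w - h)\<^sup>m\<close>, and the coefficient of
  \<open>w\<^sup>m\<^sup>-\<^sup>1\<close> shows \<open>h = - P\<^sub>m\<^sub>-\<^sub>1 / m\<close>.\<close>

section \<open>The Phragmen-Lindelof principle in a half strip\<close>

text \<open>Multiplying \<open>F\<close> by exp(-\<eta> exp(\<tau> (\<zeta> - i \<phi>))) with
  \<tau> slightly above \<sigma> makes it small far to the right without enlarging it anywhere, so
  the maximum principle applies on long rectangles; then \<eta> tends to 0. The width condition
  keeps the real part of the inner exponential positive up to both sides.\<close>

lemma phragmen_lindelof_half_strip: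
  fixes F :: "complex \<Rightarrow> complex" and X a b \<sigma> C M :: real
  defines "D \<equiv> {\<zeta>. X \<le> Re \<zeta> \<and> a \<le> Im \<zeta> \<and> Im \<zeta> \<le> b}"
  assumes hol: "F holomorphic_on D"
    and growth: "\<And>\<zeta>. \<zeta> \<in> D \<Longrightarrow> norm (F \<zeta>) \<le> exp (C * (1 + exp (\<sigma> * Re \<zeta>)))"
    and \<sigma>: "\<sigma> > 0" "\<sigma> * (b - a) < pi" and M: "M > 0"
    and bound: "\<And>\<zeta>. \<zeta> \<in> D \<Longrightarrow> Re \<zeta> = X \<or> Im \<zeta> = a \<or> Im \<zeta> = b \<Longrightarrow> norm (F \<zeta>) \<le> M"
    and z: "z \<in> D"
  shows "norm (F z) \<le> M"
proof (cases "a < b")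
  case False
  then show ?thesis using bound z by (auto simp: D_def)
next
  case True
  have "\<sigma> < pi / (b - a)" using \<sigma> True by (simp add: field_simps)
  then obtain \<tau> where \<tau>: "\<sigma> < \<tau>" "\<tau> < pi / (b - a)" using dense by blast
  then have \<tau>2: "\<tau> * (b - a) < pi" using True by (simp add: field_simps)
  define \<phi> where "\<phi> = (a + b) / 2"
  define \<kappa> where "\<kappa> = cos (\<tau> * (b - a) / 2)"
  have \<kappa>: "\<kappa> > 0" unfolding \<kappa>_def
    using \<tau>2 \<tau> \<sigma> True by (intro cos_gt_zero_pi) (auto intro!: order.strict_trans[OF _ mult_pos_pos[of \<tau> "b-a"]])
  have cos_ge: "cos (\<tau> * (Im \<zeta> - \<phi>)) \<ge> \<kappa>" if "\<zeta> \<in> D" for \<zeta>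
  proof -
    have "\<bar>Im \<zeta> - \<phi>\<bar> \<le> (b - a) / 2" using that unfolding D_def \<phi>_def by (auto simp: abs_le_iff field_simps)
    then have "\<tau> * \<bar>Im \<zeta> - \<phi>\<bar> \<le> \<tau> * ((b - a) / 2)" using \<tau> \<sigma> by (intro mult_left_mono) auto
    then have "\<bar>\<tau> * (Im \<zeta> - \<phi>)\<bar> \<le> \<tau> * (b - a) / 2" using \<tau> \<sigma> by (simp add: abs_mult)
    then have "cos (\<tau> * (b - a) / 2) \<le> cos \<bar>\<tau> * (Im \<zeta> - \<phi>)\<bar>"
      using \<tau>2 pi_gt_zero by (intro cos_monotone_0_pi_le) (auto intro: order_trans)
    then show ?thesis by (simp add: \<kappa>_def)
  qed
  define G where "G = (\<lambda>\<eta> \<zeta>. F \<zeta> * exp (- of_real \<eta> * exp (of_real \<tau> * (\<zeta> - \<i> * of_real \<phi>))))" for \<eta> :: real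
  have norm_G: "norm (G \<eta> \<zeta>) = norm (F \<zeta>) * exp (- \<eta> * exp (\<tau> * Re \<zeta>) * cos (\<tau> * (Im \<zeta> - \<phi>)))" for \<eta> \<zeta>
    by (simp add: G_def norm_mult Re_exp)
  have G_le: "norm (G \<eta> \<zeta>) \<le> norm (F \<zeta>) * exp (- \<eta> * \<kappa> * exp (\<tau> * Re \<zeta>))" if "\<eta> > 0" "\<zeta> \<in> D" for \<eta> \<zeta>
  proof -
    have "\<eta> * exp (\<tau> * Re \<zeta>) * cos (\<tau> * (Im \<zeta> - \<phi>)) \<ge> \<eta> * exp (\<tau> * Re \<zeta>) * \<kappa>"
      using cos_ge[OF that(2)] that(1) by (intro mult_left_mono) auto
    then show ?thesis unfolding norm_G by (intro mult_left_mono) (auto simp: algebra_simps)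
  qed
  have main: "norm (G \<eta> z) \<le> M" if \<eta>: "\<eta> > 0" for \<eta>
  proof -
    have "((\<lambda>T. exp (C * (1 + exp (\<sigma> * T)) - \<eta> * \<kappa> * exp (\<tau> * T))) \<longlongrightarrow> 0) at_top"
    proof -
      have "\<eta> * \<kappa> > 0" using \<eta> \<kappa> by simp
      then have "filterlim (\<lambda>T. \<eta> * \<kappa> * exp (\<tau> * T) - C * (1 + exp (\<sigma> * T))) at_top at_top"
        using \<tau>(1) \<sigma>(1) by real_asymp
      then have "((\<lambda>T. exp (- (\<eta> * \<kappa> * exp (\<tau> * T) - C * (1 + exp (\<sigma> * T))))) \<longlongrightarrow> 0) at_top"
        by (intro filterlim_compose[OF exp_at_bot]) (simp add: filterlim_uminus_at_top)
      then show ?thesis by simp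
    qed
    then have "\<forall>\<^sub>F T in at_top. exp (C * (1 + exp (\<sigma> * T)) - \<eta> * \<kappa> * exp (\<tau> * T)) < M"
      using M by (rule order_tendstoD)
    \<comment> \<open>Beyond \<open>Re z\<close>, so that the rectangle contains \<open>z\<close>,
      and so far out that the damped growth bound is below \<open>M\<close> on the right
      side.\<close>
    then obtain T where T: "T > max (Re z) X" "exp (C * (1 + exp (\<sigma> * T)) - \<eta> * \<kappa> * exp (\<tau> * T)) < M"
      using eventually_conj[OF eventually_gt_at_top[of "max (Re z) X"]] eventually_happens by fastforce
    define R where "R = cbox (Complex X a) (Complex T b)"
    have R: "\<zeta> \<in> R \<longleftrightarrow> X \<le> Re \<zeta> \<and> Re \<zeta> \<le> T \<and> a \<le> Im \<zeta> \<and> Im \<zeta> \<le> b" for \<zeta>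
      unfolding R_def in_cbox_complex_iff by auto
    have RD: "R \<subseteq> D" by (auto simp: R D_def)
    have Ghol: "G \<eta> holomorphic_on D" unfolding G_def by (intro holomorphic_intros hol)
    show ?thesis
    proof (rule maximum_modulus_frontier[of "G \<eta>" R])
      show "G \<eta> holomorphic_on interior R"
        using Ghol RD interior_subset by (meson holomorphic_on_subset order_trans)
      show "continuous_on (closure R) (G \<eta>)"
        using holomorphic_on_imp_continuous_on[OF Ghol] RD by (auto simp: R_def intro: continuous_on_subset)
      show "bounded R" by (simp add: R_def)
      show "z \<in> R" using z T by (auto simp: R D_def)
    next
      fix \<zeta> assume "\<zeta> \<in> frontier R"
      then have "\<zeta> \<in> R" "\<zeta> \<notin> box (Complex X a) (Complex T b)"
        by (auto simp: frontier_def R_def)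
      then have \<zeta>: "\<zeta> \<in> D" and cases: "Re \<zeta> = X \<or> Re \<zeta> = T \<or> Im \<zeta> = a \<or> Im \<zeta> = b"
        using RD by (auto simp: R in_box_complex_iff)
      show "norm (G \<eta> \<zeta>) \<le> M"
      proof (cases "Re \<zeta> = T")
        case True
        have "norm (G \<eta> \<zeta>) \<le> exp (C * (1 + exp (\<sigma> * Re \<zeta>))) * exp (- \<eta> * \<kappa> * exp (\<tau> * Re \<zeta>))"
          using G_le[OF \<eta> \<zeta>] growth[OF \<zeta>] by (meson exp_ge_zero mult_right_mono order_trans)
        also have "\<dots> = exp (C * (1 + exp (\<sigma> * T)) - \<eta> * \<kappa> * exp (\<tau> * T))"
          using True by (simp add: exp_diff exp_minus divide_inverse)
        finally show ?thesis using T by simp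
      next
        case False
        then have "norm (F \<zeta>) \<le> M" using bound \<zeta> cases by auto
        moreover have "norm (G \<eta> \<zeta>) \<le> norm (F \<zeta>) * 1"
          using G_le[OF \<eta> \<zeta>] by (rule order_trans) (use \<eta> \<kappa> in \<open>intro mult_left_mono, auto\<close>)
        ultimately show ?thesis by simp
      qed
    qed
  qed
  \<comment> \<open>\<open>M\<close> does not depend on \<open>\<eta>\<close>, hence the bound
    survives the limit in which the damping factor becomes 1.\<close>
  have "((\<lambda>\<eta>. norm (G \<eta> z)) \<longlongrightarrow> norm (F z)) (at_right 0)"
    unfolding norm_G by (auto intro!: tendsto_eq_intros)
  moreover have "\<forall>\<^sub>F \<eta> in at_right 0. norm (G \<eta> z) \<le> M"
    using main by (auto simp: eventually_at_filter)
  ultimately show ?thesis by (rule tendsto_upperbound) simp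
qed

section \<open>Growth in logarithmic coordinates\<close>

text \<open>Constant factors cost nothing once the exponential rate is raised by any positive
  amount.\<close>

lemma ev_absorb_exp:
  fixes k k' K \<rho> :: real
  assumes "\<rho> > 0" "k < k'"
  shows "\<forall>\<^sub>F x in at_top. K * exp (k * exp (\<rho> * x)) \<le> exp (k' * exp (\<rho> * x))"
proof -
  have "k' - k > 0" using assms by simp
  then have "filterlim (\<lambda>x. exp ((k' - k) * exp (\<rho> * x))) at_top at_top"
    using assms(1) by real_asymp
  then have "\<forall>\<^sub>F x in at_top. K \<le> exp ((k' - k) * exp (\<rho> * x))"
    by (simp add: filterlim_at_top)
  then show ?thesis
  proof eventually_elim
    case (elim x)
    then have "K * exp (k * exp (\<rho> * x)) \<le> exp ((k' - k) * exp (\<rho> * x)) * exp (k * exp (\<rho> * x))"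
      by (intro mult_right_mono) auto
    then show ?case by (simp add: exp_add[symmetric] algebra_simps)
  qed
qed

text \<open>The sector is pulled back along \<open>exp\<close> to a half strip (or a full strip if \<open>r0 = 0\<close>), which is
  convex even if \<open>\<beta> - \<alpha> > 2 * pi\<close>, and on which the comparison functions \<open>exp (c * z\<^sup>\<sigma>)\<close> become entire.
  There \<open>\<bar>z\<bar>\<^sup>\<rho>\<close> reads \<open>exp (\<rho> * Re \<zeta>)\<close>.\<close>

locale log_sector =
  fixes \<alpha> \<beta> r0 \<rho> :: real
  assumes rho: "\<rho> > 0" and r0: "r0 \<ge> 0"
begin

definition strip :: "complex set" where
  "strip = {\<zeta>. r0 < exp (Re \<zeta>) \<and> \<alpha> < Im \<zeta> \<and> Im \<zeta> < \<beta>}"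

text \<open>With r = exp x this is log g \<le> k r^\<rho> from some r on: an indicator bound with
  the limsup unfolded. Negative \<open>k\<close> expresses exponential decay.\<close>

definition ray_le :: "(complex \<Rightarrow> real) \<Rightarrow> real \<Rightarrow> real \<Rightarrow> bool" where
  "ray_le g \<theta> k \<longleftrightarrow> (\<forall>\<^sub>F x in at_top. g (Complex x \<theta>) \<le> exp (k * exp (\<rho> * x)))"

text \<open>Order at most \<open>\<rho>\<close>, and nonpositive indicator in the directions \<open>\<Theta>\<close>. Real-valued functions are
  used so that bounds need not come from holomorphic functions.\<close>

definition tame :: "real set \<Rightarrow> (complex \<Rightarrow> real) \<Rightarrow> bool" where
  "tame \<Theta> g \<longleftrightarrow> (\<forall>\<sigma>>\<rho>. \<exists>C. \<forall>\<zeta>\<in>strip. g \<zeta> \<le> exp (C * (1 + exp (\<sigma> * Re \<zeta>)))) \<and>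
     (\<forall>\<theta>\<in>\<Theta> \<inter> {\<alpha><..<\<beta>}. \<forall>\<delta>>0. ray_le g \<theta> \<delta>)"

lemma exp_strip: "exp ` strip = sector \<alpha> \<beta> r0"
proof (intro equalityI subsetI)
  fix z assume "z \<in> exp ` strip"
  then obtain \<zeta> where "\<zeta> \<in> strip" "z = exp \<zeta>" by blast
  then show "z \<in> sector \<alpha> \<beta> r0"
    unfolding sector_def strip_def
    by (force simp: rcis_def exp_eq_polar)
next
  fix z assume "z \<in> sector \<alpha> \<beta> r0"
  then obtain r \<theta> where *: "r > r0" "\<alpha> < \<theta>" "\<theta> < \<beta>" "z = rcis r \<theta>" by (auto simp: sector_def)
  then have "r > 0" using r0 by simp
  then have "z = exp (Complex (ln r) \<theta>)" using * by (simp add: rcis_def exp_eq_polar)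
  moreover have "Complex (ln r) \<theta> \<in> strip" using * \<open>r > 0\<close> by (simp add: strip_def)
  ultimately show "z \<in> exp ` strip" by blast
qed

lemma open_strip: "open strip"
  unfolding strip_def by (intro open_Collect_conj open_Collect_less continuous_intros)

lemma convex_strip: "convex strip"
proof -
  have "convex {\<zeta>. r0 < exp (Re \<zeta>)}"
  proof (cases "r0 = 0")
    case False
    then have "{\<zeta>. r0 < exp (Re \<zeta>)} = {\<zeta>. ln r0 < Re \<zeta>}"
      using r0 by (auto simp: less_eq_real_def) (metis exp_ln exp_less_cancel_iff)+
    then show ?thesis by (simp add: convex_halfspace_Re_gt)
  qed simp
  moreover have "strip = {\<zeta>. r0 < exp (Re \<zeta>)} \<inter> ({\<zeta>. Im \<zeta> > \<alpha>} \<inter> {\<zeta>. Im \<zeta> < \<beta>})"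
    by (auto simp: strip_def)
  ultimately show ?thesis
    by (auto intro!: convex_Int simp: convex_halfspace_Im_gt convex_halfspace_Im_lt)
qed

lemma ev_strip:
  assumes "\<theta> \<in> {\<alpha><..<\<beta>}"
  shows "\<forall>\<^sub>F x in at_top. Complex x \<theta> \<in> strip"
proof -
  have "filterlim (exp :: real \<Rightarrow> real) at_top at_top" by (rule exp_at_top)
  then have "\<forall>\<^sub>F x in at_top. r0 < exp (x::real)" by (auto simp: filterlim_at_top_dense)
  then show ?thesis by eventually_elim (use assms in \<open>auto simp: strip_def\<close>)
qed

section \<open>Calculus of ray bounds and tame functions\<close>

lemma ray_leI:
  assumes "\<theta> \<in> {\<alpha><..<\<beta>}" "k < k'"
    and "\<forall>\<^sub>F x in at_top. Complex x \<theta> \<in> strip \<longrightarrow> g (Complex x \<theta>) \<le> K * exp (k * exp (\<rho> * x))"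
  shows "ray_le g \<theta> k'"
  unfolding ray_le_def
  using assms(3) ev_absorb_exp[OF rho assms(2), of K] ev_strip[OF assms(1)]
  by eventually_elim auto

lemma ray_le_mono: "ray_le g \<theta> k \<Longrightarrow> k \<le> k' \<Longrightarrow> ray_le g \<theta> k'"
  unfolding ray_le_def
  by (erule eventually_mono) (auto elim!: order_trans intro!: mult_right_mono)

lemma tame_empty: "tame \<Theta> g \<Longrightarrow> tame {} g"
  by (simp add: tame_def)

lemma tame_ray: "tame \<Theta> g \<Longrightarrow> \<theta> \<in> \<Theta> \<Longrightarrow> \<theta> \<in> {\<alpha><..<\<beta>} \<Longrightarrow> \<delta> > 0 \<Longrightarrow> ray_le g \<theta> \<delta>"
  by (simp add: tame_def)

lemma tame_mono:
  assumes "tame \<Theta> h" "\<And>\<zeta>. \<zeta> \<in> strip \<Longrightarrow> g \<zeta> \<le> h \<zeta>"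
  shows "tame \<Theta> g"
  unfolding tame_def
proof (intro conjI allI impI ballI)
  fix \<sigma> assume "\<sigma> > \<rho>"
  then obtain C where "\<forall>\<zeta>\<in>strip. h \<zeta> \<le> exp (C * (1 + exp (\<sigma> * Re \<zeta>)))" using assms(1) unfolding tame_def by blast
  then show "\<exists>C. \<forall>\<zeta>\<in>strip. g \<zeta> \<le> exp (C * (1 + exp (\<sigma> * Re \<zeta>)))" using assms(2) by (meson order_trans)
next
  fix \<theta> and \<delta> :: real assume *: "\<theta> \<in> \<Theta> \<inter> {\<alpha><..<\<beta>}" "\<delta> > 0"
  then have "ray_le h \<theta> \<delta>" using assms(1) by (simp add: tame_def)
  moreover have "\<forall>\<^sub>F x in at_top. Complex x \<theta> \<in> strip" using ev_strip * by blast
  ultimately show "ray_le g \<theta> \<delta>" unfolding ray_le_def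
    by eventually_elim (use assms(2) in \<open>auto intro: order_trans\<close>)
qed

lemma tame_mult:
  assumes "tame \<Theta> g" "tame \<Theta> h" "\<And>\<zeta>. \<zeta> \<in> strip \<Longrightarrow> h \<zeta> \<ge> 0"
  shows "tame \<Theta> (\<lambda>\<zeta>. g \<zeta> * h \<zeta>)"
  unfolding tame_def
proof (intro conjI allI impI ballI)
  fix \<sigma> assume "\<sigma> > \<rho>"
  then obtain C C' where C: "\<forall>\<zeta>\<in>strip. g \<zeta> \<le> exp (C * (1 + exp (\<sigma> * Re \<zeta>)))"
     "\<forall>\<zeta>\<in>strip. h \<zeta> \<le> exp (C' * (1 + exp (\<sigma> * Re \<zeta>)))"
    using assms(1,2) unfolding tame_def by blast
  have "g \<zeta> * h \<zeta> \<le> exp ((C + C') * (1 + exp (\<sigma> * Re \<zeta>)))" if "\<zeta> \<in> strip" for \<zeta>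
    using C assms(3) that mult_mono[of "g \<zeta>" _ "h \<zeta>"] by (simp add: distrib_right exp_add)
  then show "\<exists>C. \<forall>\<zeta>\<in>strip. g \<zeta> * h \<zeta> \<le> exp (C * (1 + exp (\<sigma> * Re \<zeta>)))" by blast
next
  fix \<theta> and \<delta> :: real assume *: "\<theta> \<in> \<Theta> \<inter> {\<alpha><..<\<beta>}" "\<delta> > 0"
  then have "ray_le g \<theta> (\<delta>/2)" "ray_le h \<theta> (\<delta>/2)" using assms(1,2) by (auto simp: tame_def)
  moreover have "\<forall>\<^sub>F x in at_top. Complex x \<theta> \<in> strip" using ev_strip * by blast
  ultimately show "ray_le (\<lambda>\<zeta>. g \<zeta> * h \<zeta>) \<theta> \<delta>" unfolding ray_le_def
  proof eventually_elim
    case (elim x)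
    then have "g (Complex x \<theta>) * h (Complex x \<theta>) \<le> exp (\<delta>/2 * exp (\<rho> * x)) * exp (\<delta>/2 * exp (\<rho> * x))"
      using assms(3) by (intro mult_mono) auto
    then show ?case by (simp add: exp_add[symmetric])
  qed
qed

lemma tame_const: "tame \<Theta> (\<lambda>_. c)"
  unfolding tame_def
proof (intro conjI allI impI ballI)
  fix \<sigma> :: real
  have "c \<le> exp (\<bar>c\<bar> * (1 + exp (\<sigma> * Re \<zeta>)))" for \<zeta>
  proof -
    have "c \<le> exp \<bar>c\<bar>" using exp_ge_add_one_self[of "\<bar>c\<bar>"] by linarith
    also have "\<dots> \<le> exp (\<bar>c\<bar> * (1 + exp (\<sigma> * Re \<zeta>)))" by (simp add: distrib_left)
    finally show ?thesis .
  qed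
  then show "\<exists>C. \<forall>\<zeta>\<in>strip. c \<le> exp (C * (1 + exp (\<sigma> * Re \<zeta>)))" by blast
next
  fix \<theta> and \<delta> :: real assume *: "\<theta> \<in> \<Theta> \<inter> {\<alpha><..<\<beta>}" "\<delta> > 0"
  then show "ray_le (\<lambda>_. c) \<theta> \<delta>" using ev_absorb_exp[OF rho, of 0 \<delta> c] by (simp add: ray_le_def)
qed

lemma tame_max:
  assumes "tame \<Theta> g" "tame \<Theta> h"
  shows "tame \<Theta> (\<lambda>\<zeta>. max (g \<zeta>) (h \<zeta>))"
  unfolding tame_def
proof (intro conjI allI impI ballI)
  fix \<sigma> assume "\<sigma> > \<rho>"
  then obtain C C' where C: "\<forall>\<zeta>\<in>strip. g \<zeta> \<le> exp (C * (1 + exp (\<sigma> * Re \<zeta>)))"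
     "\<forall>\<zeta>\<in>strip. h \<zeta> \<le> exp (C' * (1 + exp (\<sigma> * Re \<zeta>)))"
    using assms unfolding tame_def by blast
  have "exp (c * (1 + exp (\<sigma> * Re \<zeta>))) \<le> exp (max C C' * (1 + exp (\<sigma> * Re \<zeta>)))" if "c \<le> max C C'" for c \<zeta>
    unfolding exp_le_cancel_iff using that by (intro mult_right_mono) (auto intro: add_nonneg_nonneg)
  then have "\<forall>\<zeta>\<in>strip. max (g \<zeta>) (h \<zeta>) \<le> exp (max C C' * (1 + exp (\<sigma> * Re \<zeta>)))"
    using C by (meson max.bounded_iff max.cobounded1 max.cobounded2 order_trans)
  then show "\<exists>C. \<forall>\<zeta>\<in>strip. max (g \<zeta>) (h \<zeta>) \<le> exp (C * (1 + exp (\<sigma> * Re \<zeta>)))" by blast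
next
  fix \<theta> and \<delta> :: real assume *: "\<theta> \<in> \<Theta> \<inter> {\<alpha><..<\<beta>}" "\<delta> > 0"
  then have "ray_le g \<theta> \<delta>" "ray_le h \<theta> \<delta>" using assms by (auto simp: tame_def)
  then show "ray_le (\<lambda>\<zeta>. max (g \<zeta>) (h \<zeta>)) \<theta> \<delta>" unfolding ray_le_def by eventually_elim simp
qed

text \<open>The sum is at most twice the largest of both terms and 0, which reduces it to products
  and maxima; the 0 provides the sign that \<open>tame_mult\<close> asks of its second
  factor.\<close>

lemma tame_add:
  assumes "tame \<Theta> g" "tame \<Theta> h"
  shows "tame \<Theta> (\<lambda>\<zeta>. g \<zeta> + h \<zeta>)"
proof (rule tame_mono)
  show "tame \<Theta> (\<lambda>\<zeta>. 2 * max 0 (max (g \<zeta>) (h \<zeta>)))"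
    by (intro tame_mult tame_max tame_const assms) auto
qed auto

lemma tame_sum:
  "finite A \<Longrightarrow> (\<And>i. i \<in> A \<Longrightarrow> tame \<Theta> (g i)) \<Longrightarrow> tame \<Theta> (\<lambda>\<zeta>. \<Sum>i\<in>A. g i \<zeta>)"
  by (induction A rule: finite_induct) (auto intro: tame_const tame_add)

lemma tame_power:
  "tame \<Theta> g \<Longrightarrow> (\<And>\<zeta>. \<zeta> \<in> strip \<Longrightarrow> g \<zeta> \<ge> 0) \<Longrightarrow> tame \<Theta> (\<lambda>\<zeta>. g \<zeta> ^ n)"
  by (induction n) (auto intro: tame_const tame_mult)


section \<open>Comparison with sinusoids\<close>

text \<open>Order at most \<open>\<rho>\<close> gives growth bounds only with exponents above
  \<open>\<rho>\<close>, so Phragmen-Lindelof at opening \<open>t\<close> needs such an exponent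
  that still fits; the strict inequality leaves room for it.\<close>

lemma obtain_larger_order:
  assumes "t \<ge> 0" "\<rho> * t < pi"
  obtains \<sigma> where "\<sigma> > \<rho>" "\<sigma> * t < pi"
proof
  \<comment> \<open>Then \<sigma> t uses up only the fraction t / (t + 1) of the gap pi - \<rho> t;
    the 1 in the denominator covers t = 0.\<close>
  define \<sigma> where "\<sigma> = \<rho> + (pi - \<rho> * t) / (t + 1)"
  show "\<sigma> > \<rho>" using assms by (simp add: \<sigma>_def)
  have "(pi - \<rho> * t) / (t + 1) * t = (pi - \<rho> * t) * (t / (t + 1))" by simp
  also have "\<dots> < (pi - \<rho> * t) * 1" using assms by (intro mult_strict_left_mono) auto
  finally show "\<sigma> * t < pi" by (simp add: \<sigma>_def distrib_right)
qed

text \<open>Absorbs comparison factors of exact order \<open>\<rho>\<close> into growth bounds with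
  exponent \<open>\<sigma>\<close>. The summand 1 serves negative \<open>x\<close>, that is, points
  of modulus below 1.\<close>

lemma exp_le_one_add_exp:
  assumes "\<sigma> > \<rho>"
  shows "exp (\<rho> * x) \<le> 1 + exp (\<sigma> * x)"
proof (cases "x \<ge> 0")
  case True
  then have "exp (\<rho> * x) \<le> exp (\<sigma> * x)" using assms by (simp add: mult_right_mono)
  then show ?thesis by (rule order_trans) simp
next
  case False
  then have "exp (\<rho> * x) \<le> 1" using rho by (simp add: mult_nonneg_nonpos)
  then show ?thesis by (simp add: add_increasing2)
qed

text \<open>The trigonometric convexity of indicators, uniformly over the directions between two
  rays. The sinusoid times exp(\<rho> x) is the imaginary part of a holomorphic function, so
  \<open>F\<close> can be divided by a holomorphic function of exactly that modulus;
  Phragmen-Lindelof bounds the quotient.\<close>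

lemma sinusoid_bound:
  fixes F :: "complex \<Rightarrow> complex" and D \<psi> \<theta>1 \<theta>2 :: real
  assumes hol: "F holomorphic_on strip" and tame: "tame {} (\<lambda>\<zeta>. norm (F \<zeta>))"
    and \<theta>: "\<theta>1 \<in> {\<alpha><..<\<beta>}" "\<theta>2 \<in> {\<alpha><..<\<beta>}" "\<rho> * \<bar>\<theta>1 - \<theta>2\<bar> < pi"
    and rays: "ray_le (\<lambda>\<zeta>. norm (F \<zeta>)) \<theta>1 (D * sin (\<rho> * (\<theta>1 - \<psi>)))"
      "ray_le (\<lambda>\<zeta>. norm (F \<zeta>)) \<theta>2 (D * sin (\<rho> * (\<theta>2 - \<psi>)))"
  obtains K X where "K > 0" "r0 < exp X"
    "\<And>x y. x \<ge> X \<Longrightarrow> y \<in> closed_segment \<theta>1 \<theta>2 \<Longrightarrow>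
       norm (F (Complex x y)) \<le> K * exp (D * sin (\<rho> * (y - \<psi>)) * exp (\<rho> * x))"
proof -
  define a b where "a = min \<theta>1 \<theta>2" and "b = max \<theta>1 \<theta>2"
  have "b - a = \<bar>\<theta>1 - \<theta>2\<bar>" by (simp add: a_def b_def min_def max_def)
  then have ab: "a \<le> b" "\<alpha> < a" "b < \<beta>" "\<rho> * (b - a) < pi" "\<theta>1 = a \<and> \<theta>2 = b \<or> \<theta>1 = b \<and> \<theta>2 = a"
    using \<theta> by (auto simp: a_def b_def min_def max_def)
  have seg: "closed_segment \<theta>1 \<theta>2 = {a..b}"
    by (auto simp: closed_segment_eq_real_ivl a_def b_def)
  have "ray_le (\<lambda>\<zeta>. norm (F \<zeta>)) a (D * sin (\<rho> * (a - \<psi>)))"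
      "ray_le (\<lambda>\<zeta>. norm (F \<zeta>)) b (D * sin (\<rho> * (b - \<psi>)))" using ab rays by auto
  moreover have "\<forall>\<^sub>F x in at_top. Complex x \<theta>1 \<in> strip" using ev_strip \<theta> by blast
  ultimately have "\<forall>\<^sub>F x in at_top. norm (F (Complex x a)) \<le> exp (D * sin (\<rho> * (a - \<psi>)) * exp (\<rho> * x))
     \<and> norm (F (Complex x b)) \<le> exp (D * sin (\<rho> * (b - \<psi>)) * exp (\<rho> * x)) \<and> Complex x \<theta>1 \<in> strip"
    unfolding ray_le_def by eventually_elim auto
  then obtain X where X: "\<And>x. x \<ge> X \<Longrightarrow> norm (F (Complex x a)) \<le> exp (D * sin (\<rho> * (a - \<psi>)) * exp (\<rho> * x))"
     "\<And>x. x \<ge> X \<Longrightarrow> norm (F (Complex x b)) \<le> exp (D * sin (\<rho> * (b - \<psi>)) * exp (\<rho> * x))"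
     "\<And>x. x \<ge> X \<Longrightarrow> Complex x \<theta>1 \<in> strip"
    unfolding eventually_at_top_linorder by blast
  have X0: "r0 < exp x" if "x \<ge> X" for x using X(3)[OF that] by (simp add: strip_def)
  \<comment> \<open>For w = D exp(\<rho> (\<zeta> - i \<psi>)) the modulus of exp(i w) is exp(- Im
    w), the inverse of the desired bound. \<open>D\<close> may have either sign.\<close>
  define G where "G = (\<lambda>\<zeta>. F \<zeta> * exp (of_real D * \<i> * exp (of_real \<rho> * (\<zeta> - \<i> * of_real \<psi>))))"
  have norm_G: "norm (G \<zeta>) = norm (F \<zeta>) * exp (- (D * sin (\<rho> * (Im \<zeta> - \<psi>)) * exp (\<rho> * Re \<zeta>)))" for \<zeta>
    by (simp add: G_def norm_mult Im_exp mult_ac)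
  define S where "S = {\<zeta>. X \<le> Re \<zeta> \<and> a \<le> Im \<zeta> \<and> Im \<zeta> \<le> b}"
  have S: "S \<subseteq> strip" using X0 ab by (auto simp: S_def strip_def)
  have Ghol: "G holomorphic_on S" unfolding G_def
    by (intro holomorphic_intros holomorphic_on_subset[OF hol S])
  obtain \<sigma> where "\<sigma> > \<rho>" and \<sigma>: "\<sigma> * (b - a) < pi"
    using ab by (elim obtain_larger_order[rotated]) auto
  obtain C where C: "\<And>\<zeta>. \<zeta> \<in> strip \<Longrightarrow> norm (F \<zeta>) \<le> exp (C * (1 + exp (\<sigma> * Re \<zeta>)))"
    using tame \<open>\<sigma> > \<rho>\<close> unfolding tame_def by blast
  have growth: "norm (G \<zeta>) \<le> exp ((C + \<bar>D\<bar>) * (1 + exp (\<sigma> * Re \<zeta>)))" if "\<zeta> \<in> S" for \<zeta>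
  proof -
    have "- (D * sin (\<rho> * (Im \<zeta> - \<psi>)) * exp (\<rho> * Re \<zeta>)) \<le> \<bar>D * sin (\<rho> * (Im \<zeta> - \<psi>)) * exp (\<rho> * Re \<zeta>)\<bar>" by simp
    also have "\<dots> \<le> \<bar>D\<bar> * exp (\<rho> * Re \<zeta>)" by (auto simp: abs_mult intro!: mult_right_mono mult_left_le)
    also have "\<dots> \<le> \<bar>D\<bar> * (1 + exp (\<sigma> * Re \<zeta>))"
      using exp_le_one_add_exp[OF \<open>\<sigma> > \<rho>\<close>] by (intro mult_left_mono) auto
    finally have "norm (G \<zeta>) \<le> exp (C * (1 + exp (\<sigma> * Re \<zeta>))) * exp (\<bar>D\<bar> * (1 + exp (\<sigma> * Re \<zeta>)))"
      unfolding norm_G using C S that by (intro mult_mono) auto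
    then show ?thesis by (simp add: distrib_right exp_add)
  qed
  have rayG: "norm (G \<zeta>) \<le> 1" if "\<zeta> \<in> S" "Im \<zeta> = a \<or> Im \<zeta> = b" for \<zeta>
  proof -
    have "norm (F \<zeta>) \<le> exp (D * sin (\<rho> * (Im \<zeta> - \<psi>)) * exp (\<rho> * Re \<zeta>))"
      using X(1,2)[of "Re \<zeta>"] that by (cases \<zeta>) (auto simp: S_def)
    then show ?thesis unfolding norm_G by (simp add: exp_minus field_simps)
  qed
  \<comment> \<open>The rectangle degenerates to the left side of the half strip, where compactness
    bounds \<open>G\<close>; on the two rays the bound is 1.\<close>
  have "compact (G ` cbox (Complex X a) (Complex X b))"
    by (intro compact_continuous_image continuous_on_subset[OF holomorphic_on_imp_continuous_on[OF Ghol]])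
       (auto simp: S_def in_cbox_complex_iff)
  then obtain M :: real where M: "\<And>\<zeta>. \<zeta> \<in> cbox (Complex X a) (Complex X b) \<Longrightarrow> norm (G \<zeta>) \<le> M"
    by (metis bounded_iff compact_imp_bounded imageI)
  have *: "norm (G \<zeta>) \<le> max 1 M" if "\<zeta> \<in> S" for \<zeta>
  proof (rule phragmen_lindelof_half_strip[where F = G and X = X and a = a and b = b and C = "C + \<bar>D\<bar>" and \<sigma> = \<sigma>],
      fold S_def)
    fix \<zeta> assume "\<zeta> \<in> S" "Re \<zeta> = X \<or> Im \<zeta> = a \<or> Im \<zeta> = b"
    then show "norm (G \<zeta>) \<le> max 1 M"
      using rayG[of \<zeta>] M[of \<zeta>] by (auto simp: S_def in_cbox_complex_iff max_def)
  qed (use Ghol growth \<sigma> rho \<open>\<sigma> > \<rho>\<close> that in \<open>auto simp: S_def\<close>)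
  show ?thesis
  proof (rule that[of "max 1 M" X])
    fix x y assume "x \<ge> X" "y \<in> closed_segment \<theta>1 \<theta>2"
    then have "norm (G (Complex x y)) \<le> max 1 M" using * seg by (auto simp: S_def)
    then show "norm (F (Complex x y)) \<le> max 1 M * exp (D * sin (\<rho> * (y - \<psi>)) * exp (\<rho> * x))"
      unfolding norm_G by (simp add: exp_minus field_simps)
  qed (use X0 in auto)
qed

text \<open>Smallness is uniform over the wedge and not merely ray by ray, which later allows
  continuity arguments across directions. The comparison sinusoid is at least -c on both rays and at
  most -c / 2 on the whole wedge.\<close>

lemma small_between_decaying_rays:
  fixes F :: "complex \<Rightarrow> complex"
  assumes hol: "F holomorphic_on strip" and tame: "tame {} (\<lambda>\<zeta>. norm (F \<zeta>))"
    and \<theta>: "\<theta>1 \<in> {\<alpha><..<\<beta>}" "\<theta>2 \<in> {\<alpha><..<\<beta>}" "\<rho> * \<bar>\<theta>1 - \<theta>2\<bar> \<le> pi / 4"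
    and c: "c > 0" "ray_le (\<lambda>\<zeta>. norm (F \<zeta>)) \<theta>1 (- c)" "ray_le (\<lambda>\<zeta>. norm (F \<zeta>)) \<theta>2 (- c)"
    and e: "e > 0"
  obtains X where "r0 < exp X"
    "\<And>x y. x \<ge> X \<Longrightarrow> y \<in> closed_segment \<theta>1 \<theta>2 \<Longrightarrow> norm (F (Complex x y)) < e"
proof -
  \<comment> \<open>This phase puts \<open>\<rho> * (\<psi> - y)\<close> between pi / 4 and pi / 2
    for all directions \<open>y\<close> of the wedge.\<close>
  define \<psi> where "\<psi> = max \<theta>1 \<theta>2 + pi / (4 * \<rho>)"
  have r: "ray_le (\<lambda>\<zeta>. norm (F \<zeta>)) \<theta> (c * sin (\<rho> * (\<theta> - \<psi>)))" if "ray_le (\<lambda>\<zeta>. norm (F \<zeta>)) \<theta> (- c)" for \<theta>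
  proof (rule ray_le_mono[OF that])
    show "- c \<le> c * sin (\<rho> * (\<theta> - \<psi>))" using c mult_left_mono[of "-1" "sin (\<rho> * (\<theta> - \<psi>))" c] by simp
  qed
  have \<rho>2: "\<rho> * \<bar>\<theta>1 - \<theta>2\<bar> < pi" using \<theta>(3) pi_gt_zero by linarith
  obtain K X where KX: "K > 0" "r0 < exp X"
    "\<And>x y. x \<ge> X \<Longrightarrow> y \<in> closed_segment \<theta>1 \<theta>2 \<Longrightarrow>
       norm (F (Complex x y)) \<le> K * exp (c * sin (\<rho> * (y - \<psi>)) * exp (\<rho> * x))"
    by (rule sinusoid_bound[OF hol tame \<theta>(1,2) \<rho>2 r[OF c(2)] r[OF c(3)]]) blast
  have sin_le: "sin (\<rho> * (y - \<psi>)) \<le> - (1 / 2)" if "y \<in> closed_segment \<theta>1 \<theta>2" for y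
  proof -
    have y: "min \<theta>1 \<theta>2 \<le> y" "y \<le> max \<theta>1 \<theta>2" using that by (auto simp: closed_segment_eq_real_ivl split: if_splits)
    have "\<rho> * (\<psi> - y) = \<rho> * (max \<theta>1 \<theta>2 - y) + pi / 4" using rho by (simp add: \<psi>_def field_simps)
    moreover have "0 \<le> \<rho> * (max \<theta>1 \<theta>2 - y)" using y rho by simp
    moreover have "\<rho> * (max \<theta>1 \<theta>2 - y) \<le> \<rho> * \<bar>\<theta>1 - \<theta>2\<bar>" using y rho by (intro mult_left_mono) auto
    ultimately have "pi / 6 \<le> \<rho> * (\<psi> - y)" "\<rho> * (\<psi> - y) \<le> pi / 2" using \<theta>(3) pi_gt_zero by linarith+
    then have "sin (pi / 6) \<le> sin (\<rho> * (\<psi> - y))" by (intro sin_monotone_2pi_le) (use pi_gt_zero in linarith)+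
    moreover have "sin (\<rho> * (\<psi> - y)) = - sin (\<rho> * (y - \<psi>))" 
      by (metis minus_diff_eq mult_minus_right sin_minus)
    ultimately show ?thesis by (simp add: sin_30)
  qed
  have "((\<lambda>x. K * exp (- (c / 2) * exp (\<rho> * x))) \<longlongrightarrow> 0) at_top" using c rho by real_asymp
  then have "\<forall>\<^sub>F x in at_top. K * exp (- (c / 2) * exp (\<rho> * x)) < e" using e by (rule order_tendstoD)
  then obtain X' where X': "\<And>x. x \<ge> X' \<Longrightarrow> K * exp (- (c / 2) * exp (\<rho> * x)) < e"
    unfolding eventually_at_top_linorder by blast
  show ?thesis
  proof (rule that[of "max X X'"])
    show "r0 < exp (max X X')" using KX(2) by (rule order.strict_trans2) simp
    fix x y assume *: "x \<ge> max X X'" "y \<in> closed_segment \<theta>1 \<theta>2"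
    have "c * sin (\<rho> * (y - \<psi>)) \<le> c * - (1 / 2)" using sin_le[OF *(2)] c by (intro mult_left_mono) auto
    then have "K * exp (c * sin (\<rho> * (y - \<psi>)) * exp (\<rho> * x)) \<le> K * exp (- (c / 2) * exp (\<rho> * x))"
      using KX(1) by (intro mult_left_mono) (auto intro!: mult_right_mono[of _ "- (c / 2)", simplified])
    then show "norm (F (Complex x y)) < e" using KX(3)[of x y] X'[of x] * by simp
  qed
qed

text \<open>A sinusoid that is -c at \<open>\<theta>1\<close> and changes sign only beyond
  \<open>\<theta>\<close> is positive at some further direction \<open>\<theta>2\<close>, where the
  nonpositive indicator of \<open>F\<close> suffices. Comparison in between leaves a negative rate
  at \<open>\<theta>\<close>.\<close>

lemma decay_spreads:
  fixes F :: "complex \<Rightarrow> complex"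
  assumes hol: "F holomorphic_on strip" and tame: "tame UNIV (\<lambda>\<zeta>. norm (F \<zeta>))"
    and \<theta>: "\<theta>1 \<in> {\<alpha><..<\<beta>}" "\<theta> \<in> {\<alpha><..<\<beta>}" "\<bar>\<theta> - \<theta>1\<bar> < pi / \<rho>"
    and c: "c > 0" "ray_le (\<lambda>\<zeta>. norm (F \<zeta>)) \<theta>1 (- c)"
  shows "\<exists>c'>0. ray_le (\<lambda>\<zeta>. norm (F \<zeta>)) \<theta> (- c')"
proof -
  have aux: ?thesis if \<theta>2: "\<theta>2 \<in> {\<alpha><..<\<beta>}" "\<bar>\<theta>2 - \<theta>1\<bar> < pi / \<rho>" "\<theta> \<in> closed_segment \<theta>1 \<theta>2" 
    "D * sin (\<rho> * (\<theta>1 - \<psi>)) = - c" "D * sin (\<rho> * (\<theta>2 - \<psi>)) > 0" "D * sin (\<rho> * (\<theta> - \<psi>)) < 0" for \<theta>2 D \<psi>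
  proof -
    have r: "\<rho> * \<bar>\<theta>1 - \<theta>2\<bar> < pi" using \<theta>2(2) rho by (simp add: field_simps abs_minus_commute)
    have ray1: "ray_le (\<lambda>\<zeta>. norm (F \<zeta>)) \<theta>1 (D * sin (\<rho> * (\<theta>1 - \<psi>)))" using c \<theta>2 by simp
    obtain K X where KX: "K > 0" "r0 < exp X"
    "\<And>x y. x \<ge> X \<Longrightarrow> y \<in> closed_segment \<theta>1 \<theta>2 \<Longrightarrow>
       norm (F (Complex x y)) \<le> K * exp (D * sin (\<rho> * (y - \<psi>)) * exp (\<rho> * x))"
      by (rule sinusoid_bound[OF hol tame_empty[OF tame] \<theta>(1) \<theta>2(1) r ray1 tame_ray[OF tame UNIV_I \<theta>2(1,5)]]) blast
    have "\<forall>\<^sub>F x in at_top. norm (F (Complex x \<theta>)) \<le> K * exp (D * sin (\<rho> * (\<theta> - \<psi>)) * exp (\<rho> * x))"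
      using eventually_ge_at_top[of X] by eventually_elim (use \<theta>2 KX in auto)
    then have ray: "\<forall>\<^sub>F x in at_top. Complex x \<theta> \<in> strip \<longrightarrow>
        norm (F (Complex x \<theta>)) \<le> K * exp (D * sin (\<rho> * (\<theta> - \<psi>)) * exp (\<rho> * x))"
      by eventually_elim simp
    \<comment> \<open>Halving the negative rate absorbs the factor \<open>K\<close>.\<close>
    have "ray_le (\<lambda>\<zeta>. norm (F \<zeta>)) \<theta> (D * sin (\<rho> * (\<theta> - \<psi>)) / 2)"
      by (rule ray_leI[OF \<theta>(2) _ ray]) (use \<theta>2 in simp)
    then show ?thesis using \<theta>2(6) by (intro exI[of _ "- (D * sin (\<rho> * (\<theta> - \<psi>)) / 2)"]) auto
  qed
  consider "\<theta> = \<theta>1" | "\<theta> > \<theta>1" | "\<theta> < \<theta>1" by linarith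
  then show ?thesis
  proof cases
    case 1
    then show ?thesis using c by blast
  next
    case 2
    then have "\<theta> < min \<beta> (\<theta>1 + pi / \<rho>)" using \<theta> by auto
    then obtain \<theta>2 where \<theta>2: "\<theta> < \<theta>2" "\<theta>2 < \<beta>" "\<theta>2 < \<theta>1 + pi / \<rho>" using dense by (metis min_less_iff_conj)
    \<comment> \<open>The zero of the sinusoid is placed midway between \<open>\<theta>\<close> and
      \<open>\<theta>2\<close>; \<open>D\<close> then normalizes its value at
      \<open>\<theta>1\<close> to -c.\<close>
    define \<psi> where "\<psi> = (\<theta> + \<theta>2) / 2"
    have \<psi>: "\<theta> < \<psi>" "\<psi> < \<theta>2" using \<theta>2 by (auto simp: \<psi>_def)
    have pos: "sin (\<rho> * t) > 0" if "0 < t" "t < pi / \<rho>" for t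
      using that rho by (intro sin_gt_zero) (auto simp: field_simps)
    have neg: "sin (\<rho> * (s - t)) = - sin (\<rho> * (t - s))" for s t by (metis minus_diff_eq mult_minus_right sin_minus)
    define D where "D = c / sin (\<rho> * (\<psi> - \<theta>1))"
    have s: "sin (\<rho> * (\<psi> - \<theta>1)) > 0" using 2 \<theta>2 \<psi> by (intro pos) auto
    then have D: "D > 0" using c by (simp add: D_def)
    show ?thesis
    proof (rule aux[of \<theta>2 D \<psi>])
      show "D * sin (\<rho> * (\<theta>1 - \<psi>)) = - c" unfolding neg[of \<theta>1] using s by (simp add: D_def)
      show "D * sin (\<rho> * (\<theta>2 - \<psi>)) > 0" using D 2 \<theta>2 \<psi> by (intro mult_pos_pos pos) auto
      show "D * sin (\<rho> * (\<theta> - \<psi>)) < 0" unfolding neg[of \<theta>] using D 2 \<theta>2 \<psi> pos[of "\<psi> - \<theta>"] by simp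
    qed (use 2 \<theta>2 \<theta> in \<open>auto simp: closed_segment_eq_real_ivl\<close>)
  next
    case 3
    then have "max \<alpha> (\<theta>1 - pi / \<rho>) < \<theta>" using \<theta> by auto
    then obtain \<theta>2 where \<theta>2: "\<theta>2 < \<theta>" "\<alpha> < \<theta>2" "\<theta>1 - pi / \<rho> < \<theta>2" using dense by (metis max_less_iff_conj)
    define \<psi> where "\<psi> = (\<theta> + \<theta>2) / 2"
    have \<psi>: "\<psi> < \<theta>" "\<theta>2 < \<psi>" using \<theta>2 by (auto simp: \<psi>_def)
    have pos: "sin (\<rho> * t) > 0" if "0 < t" "t < pi / \<rho>" for t
      using that rho by (intro sin_gt_zero) (auto simp: field_simps)
    have neg: "sin (\<rho> * (s - t)) = - sin (\<rho> * (t - s))" for s t by (metis minus_diff_eq mult_minus_right sin_minus)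
    \<comment> \<open>In the mirror image \<open>\<theta>2\<close> lies below
      \<open>\<theta>\<close>, so the amplitude is negative.\<close>
    define D where "D = - c / sin (\<rho> * (\<theta>1 - \<psi>))"
    have s: "sin (\<rho> * (\<theta>1 - \<psi>)) > 0" using 3 \<theta>2 \<psi> by (intro pos) auto
    then have D: "D < 0" using c by (simp add: D_def)
    show ?thesis
    proof (rule aux[of \<theta>2 D \<psi>])
      show "D * sin (\<rho> * (\<theta>1 - \<psi>)) = - c" using s by (simp add: D_def)
      show "D * sin (\<rho> * (\<theta>2 - \<psi>)) > 0" unfolding neg[of \<theta>2] using D 3 \<theta>2 \<psi> pos[of "\<psi> - \<theta>2"]
        by (simp add: mult_neg_pos)
      show "D * sin (\<rho> * (\<theta> - \<psi>)) < 0" using D 3 \<theta>2 \<psi> pos[of "\<theta> - \<psi>"] by (simp add: mult_neg_pos)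
    qed (use 3 \<theta>2 \<theta> in \<open>auto simp: closed_segment_eq_real_ivl\<close>)
  qed
qed


text \<open>In a sector of opening \<open>\<pi> / \<rho>\<close> with bisector \<open>\<phi>\<close> on whose sides \<open>F\<close> decays, \<open>F(z) exp (N z\<^sup>\<rho>)\<close>
  (with \<open>z\<^sup>\<rho>\<close> real on the bisector) is bounded on two rays \<open>\<phi> \<plusminus> \<eta> / \<rho>\<close>, with \<open>\<eta> < \<pi> / 2\<close> depending on \<open>N\<close>
  but a bound \<open>K\<close> independent of \<open>N\<close>. Letting \<open>N \<rightarrow> \<infinity>\<close> gives \<open>F = 0\<close> on the bisector.\<close>

lemma tame_decaying_eq_0:
  fixes F :: "complex \<Rightarrow> complex"
  assumes width: "\<beta> - \<alpha> > pi / \<rho>"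
    and hol: "F holomorphic_on strip" and tame: "tame UNIV (\<lambda>\<zeta>. norm (F \<zeta>))"
    and \<theta>1: "\<theta>1 \<in> {\<alpha><..<\<beta>}"
    and c1: "c1 > 0" "ray_le (\<lambda>\<zeta>. norm (F \<zeta>)) \<theta>1 (- c1)"
    and w: "w \<in> strip"
  shows "F w = 0"
proof -
  define L where "L = pi / \<rho>"
  have L: "L > 0" "\<rho> * L = pi" using rho by (auto simp: L_def)
  \<comment> \<open>The opening larger than pi / \<rho> enters here: \<open>\<theta>1\<close> fits
    strictly inside an interval from \<open>a\<close> to \<open>a + L\<close> within the available
    directions, so decay spreads to both ends.\<close>
  have "max \<alpha> (\<theta>1 - L) < min \<theta>1 (\<beta> - L)" using \<theta>1 width L by (auto simp: L_def)
  then obtain a where a: "max \<alpha> (\<theta>1 - L) < a" "a < min \<theta>1 (\<beta> - L)" using dense by blast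
  define b \<phi> where "b = a + L" and "\<phi> = a + L / 2"
  have in_int: "a \<in> {\<alpha><..<\<beta>}" "b \<in> {\<alpha><..<\<beta>}" "\<phi> \<in> {\<alpha><..<\<beta>}"
    and dist: "\<bar>a - \<theta>1\<bar> < L" "\<bar>b - \<theta>1\<bar> < L" "\<bar>\<phi> - \<theta>1\<bar> < L"
    using a L by (auto simp: b_def \<phi>_def abs_less_iff)
  note spread = decay_spreads[OF hol tame \<theta>1 _ _ c1, folded L_def]
  obtain ca cb c\<phi> where cs: "ca > 0" "cb > 0" "c\<phi> > 0" "ray_le (\<lambda>\<zeta>. norm (F \<zeta>)) a (- ca)"
    "ray_le (\<lambda>\<zeta>. norm (F \<zeta>)) b (- cb)" "ray_le (\<lambda>\<zeta>. norm (F \<zeta>)) \<phi> (- c\<phi>)"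
    using spread[OF in_int(1) dist(1)] spread[OF in_int(2) dist(2)] spread[OF in_int(3) dist(3)] by blast
  define c where "c = min ca cb"
  have c: "c > 0" using cs by (simp add: c_def)
  have rays: "ray_le (\<lambda>\<zeta>. norm (F \<zeta>)) a (- c)" "ray_le (\<lambda>\<zeta>. norm (F \<zeta>)) b (- c)"
    "ray_le (\<lambda>\<zeta>. norm (F \<zeta>)) \<phi> 0"
    by (rule ray_le_mono[OF cs(4)], simp add: c_def, rule ray_le_mono[OF cs(5)], simp add: c_def,
        rule ray_le_mono[OF cs(6)], use cs in simp)
  have b\<phi>: "\<rho> * (b - \<phi>) = pi / 2" "\<rho> * (a - \<phi>) = - (pi / 2)" "\<bar>\<phi> - b\<bar> = L / 2" "\<bar>\<phi> - a\<bar> = L / 2"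
    using L by (auto simp: b_def \<phi>_def field_simps)
  have sines: "- c * sin (\<rho> * (b - \<phi>)) = - c" "c * sin (\<rho> * (a - \<phi>)) = - c"
    unfolding b\<phi> by simp_all
  have half: "\<rho> * (L / 2) < pi" using L by simp
  \<comment> \<open>An interval of length exactly pi / \<rho> is too long for one use of
    \<open>sinusoid_bound\<close>. Its halves are compared separately, with the value -c at the ends
    and 0 on the bisector.\<close>
  obtain K1 X1 where K1: "K1 > 0" "r0 < exp X1" "\<And>x y. x \<ge> X1 \<Longrightarrow> y \<in> closed_segment \<phi> b \<Longrightarrow>
       norm (F (Complex x y)) \<le> K1 * exp (- c * sin (\<rho> * (y - \<phi>)) * exp (\<rho> * x))"
    by (rule sinusoid_bound[OF hol tame_empty[OF tame] in_int(3,2), of "-c" \<phi>])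
       (use rays half in \<open>simp_all only: sines b\<phi>(3,4), simp_all\<close>)
  obtain K2 X2 where K2: "K2 > 0" "r0 < exp X2" "\<And>x y. x \<ge> X2 \<Longrightarrow> y \<in> closed_segment \<phi> a \<Longrightarrow>
       norm (F (Complex x y)) \<le> K2 * exp (c * sin (\<rho> * (y - \<phi>)) * exp (\<rho> * x))"
    by (rule sinusoid_bound[OF hol tame_empty[OF tame] in_int(3,1), of c \<phi>])
       (use rays half in \<open>simp_all only: sines b\<phi>(3,4), simp_all\<close>)
  define K X where "K = max K1 K2" and "X = max X1 X2"
  have K: "K > 0" using K1 by (simp add: K_def)
  have X0: "r0 < exp x" if "x \<ge> X" for x
    using K1(2) by (rule order.strict_trans2) (use that in \<open>simp add: X_def\<close>)
  have bnd: "norm (F (Complex x y)) \<le> K * exp (- c * sin (\<rho> * \<bar>y - \<phi>\<bar>) * exp (\<rho> * x))"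
    if "x \<ge> X" "\<bar>y - \<phi>\<bar> \<le> L / 2" for x y
  proof (cases "y \<ge> \<phi>")
    case True
    then have "y \<in> closed_segment \<phi> b" using that L by (auto simp: closed_segment_eq_real_ivl b_def \<phi>_def)
    then have "norm (F (Complex x y)) \<le> K1 * exp (- c * sin (\<rho> * (y - \<phi>)) * exp (\<rho> * x))"
      using K1 that by (auto simp: X_def)
    also have "\<dots> \<le> K * exp (- c * sin (\<rho> * \<bar>y - \<phi>\<bar>) * exp (\<rho> * x))"
      using True by (auto simp: K_def)
    finally show ?thesis .
  next
    case False
    then have "y \<in> closed_segment \<phi> a" using that L by (auto simp: closed_segment_eq_real_ivl \<phi>_def)
    then have "norm (F (Complex x y)) \<le> K2 * exp (c * sin (\<rho> * (y - \<phi>)) * exp (\<rho> * x))"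
      using K2 that by (auto simp: X_def)
    also have "sin (\<rho> * (y - \<phi>)) = - sin (\<rho> * \<bar>y - \<phi>\<bar>)"
      using False by (simp add: abs_if) (metis minus_diff_eq mult_minus_right sin_minus)
    finally have "norm (F (Complex x y)) \<le> K2 * exp (- c * sin (\<rho> * \<bar>y - \<phi>\<bar>) * exp (\<rho> * x))" by simp
    also have "\<dots> \<le> K * exp (- c * sin (\<rho> * \<bar>y - \<phi>\<bar>) * exp (\<rho> * x))"
      by (auto simp: K_def)
    finally show ?thesis .
  qed
  have super: "norm (F (Complex x \<phi>)) \<le> K * exp (real N * exp (\<rho> * X)) * exp (- (real N * exp (\<rho> * x)))"
    if x: "x \<ge> X" for N x
  proof -
    \<comment> \<open>With tan \<eta> = N / c the gain N cos \<eta> on the rays at distance \<eta> /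
      \<rho> from the bisector exactly cancels the decay c sin \<eta>. The factor exp(N exp(\<rho>
      X)) in the bound is due to the left side.\<close>
    define \<eta> where "\<eta> = arctan (real N / c)"
    have \<eta>: "0 \<le> \<eta>" "\<eta> < pi / 2" using c arctan_ubound by (auto simp: \<eta>_def)
    have cos_eta: "cos \<eta> > 0" using \<eta> by (intro cos_gt_zero_pi) auto
    have "tan \<eta> = real N / c" by (simp add: \<eta>_def tan_arctan)
    then have tan: "real N * cos \<eta> = c * sin \<eta>" using c cos_eta by (simp add: tan_def field_simps)
    define G where "G = (\<lambda>\<zeta>. F \<zeta> * exp (of_nat N * exp (of_real \<rho> * (\<zeta> - \<i> * of_real \<phi>))))"
    have norm_G: "norm (G \<zeta>) = norm (F \<zeta>) * exp (real N * exp (\<rho> * Re \<zeta>) * cos (\<rho> * (Im \<zeta> - \<phi>)))" for \<zeta>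
      by (simp add: G_def norm_mult Re_exp)
    define S where "S = {\<zeta>. X \<le> Re \<zeta> \<and> \<phi> - \<eta> / \<rho> \<le> Im \<zeta> \<and> Im \<zeta> \<le> \<phi> + \<eta> / \<rho>}"
    have "\<eta> / \<rho> < L / 2" using \<eta> rho by (simp add: L_def field_simps)
    have S_im: "\<rho> * \<bar>Im \<zeta> - \<phi>\<bar> \<le> \<eta>" "\<bar>Im \<zeta> - \<phi>\<bar> \<le> L / 2" if "\<zeta> \<in> S" for \<zeta>
    proof -
      have *: "\<bar>Im \<zeta> - \<phi>\<bar> \<le> \<eta> / \<rho>" using that by (auto simp: S_def abs_le_iff)
      show "\<rho> * \<bar>Im \<zeta> - \<phi>\<bar> \<le> \<eta>" using * rho by (simp add: field_simps)
      show "\<bar>Im \<zeta> - \<phi>\<bar> \<le> L / 2" using * \<open>\<eta> / \<rho> < L / 2\<close> by linarith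
    qed
    have S: "S \<subseteq> strip"
    proof
      fix \<zeta> assume "\<zeta> \<in> S"
      then have "\<bar>Im \<zeta> - \<phi>\<bar> \<le> L / 2" "X \<le> Re \<zeta>" using S_im by (auto simp: S_def)
      then show "\<zeta> \<in> strip" using X0 in_int by (auto simp: strip_def \<phi>_def b_def abs_le_iff field_simps)
    qed
    obtain \<sigma> where \<sigma>: "\<sigma> > \<rho>" "\<sigma> * (2 * \<eta> / \<rho>) < pi"
      by (rule obtain_larger_order[of "2 * \<eta> / \<rho>"]) (use \<eta> rho in auto)
    obtain C where C: "\<And>\<zeta>. \<zeta> \<in> strip \<Longrightarrow> norm (F \<zeta>) \<le> exp (C * (1 + exp (\<sigma> * Re \<zeta>)))"
      using tame \<sigma>(1) unfolding tame_def by blast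
    have "norm (G (Complex x \<phi>)) \<le> K * exp (real N * exp (\<rho> * X))"
    proof (rule phragmen_lindelof_half_strip[where F = G and X = X and a = "\<phi> - \<eta> / \<rho>" and b = "\<phi> + \<eta> / \<rho>"
          and C = "C + real N" and \<sigma> = \<sigma>], fold S_def)
      show "G holomorphic_on S" unfolding G_def
        by (intro holomorphic_intros holomorphic_on_subset[OF hol S])
    next
      fix \<zeta> assume \<zeta>: "\<zeta> \<in> S"
      have "real N * exp (\<rho> * Re \<zeta>) * cos (\<rho> * (Im \<zeta> - \<phi>)) \<le> real N * exp (\<rho> * Re \<zeta>)"
        by (intro mult_left_le) auto
      also have "\<dots> \<le> real N * (1 + exp (\<sigma> * Re \<zeta>))" using exp_le_one_add_exp[OF \<sigma>(1)] by (intro mult_left_mono) auto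
      finally have "norm (G \<zeta>) \<le> exp (C * (1 + exp (\<sigma> * Re \<zeta>))) * exp (real N * (1 + exp (\<sigma> * Re \<zeta>)))"
        unfolding norm_G using C S \<zeta> by (intro mult_mono) auto
      then show "norm (G \<zeta>) \<le> exp ((C + real N) * (1 + exp (\<sigma> * Re \<zeta>)))"
        by (simp add: distrib_right exp_add)
    next
      fix \<zeta> assume \<zeta>: "\<zeta> \<in> S" and cases: "Re \<zeta> = X \<or> Im \<zeta> = \<phi> - \<eta> / \<rho> \<or> Im \<zeta> = \<phi> + \<eta> / \<rho>"
      have F: "norm (F \<zeta>) \<le> K * exp (- c * sin (\<rho> * \<bar>Im \<zeta> - \<phi>\<bar>) * exp (\<rho> * Re \<zeta>))"
        using bnd[of "Re \<zeta>" "Im \<zeta>"] S_im[OF \<zeta>] \<zeta> by (auto simp: S_def)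
      have cos_abs: "cos (\<rho> * (Im \<zeta> - \<phi>)) = cos (\<rho> * \<bar>Im \<zeta> - \<phi>\<bar>)"
        using rho by (metis abs_mult abs_of_pos cos_abs_real)
      have "norm (G \<zeta>) \<le> K * exp (- c * sin (\<rho> * \<bar>Im \<zeta> - \<phi>\<bar>) * exp (\<rho> * Re \<zeta>)) *
          exp (real N * exp (\<rho> * Re \<zeta>) * cos (\<rho> * \<bar>Im \<zeta> - \<phi>\<bar>))"
        unfolding norm_G cos_abs using F by (intro mult_right_mono) auto
      also have "\<dots> = K * exp ((real N * cos (\<rho> * \<bar>Im \<zeta> - \<phi>\<bar>) - c * sin (\<rho> * \<bar>Im \<zeta> - \<phi>\<bar>)) * exp (\<rho> * Re \<zeta>))"
        by (simp add: exp_add[symmetric] algebra_simps)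
      also have "\<dots> \<le> K * exp (real N * exp (\<rho> * X))"
      proof (cases "Re \<zeta> = X")
        case True
        have "sin (\<rho> * \<bar>Im \<zeta> - \<phi>\<bar>) \<ge> 0" using S_im[OF \<zeta>] \<eta> rho by (intro sin_ge_zero) (auto intro: order_trans)
        then have "real N * cos (\<rho> * \<bar>Im \<zeta> - \<phi>\<bar>) - c * sin (\<rho> * \<bar>Im \<zeta> - \<phi>\<bar>) \<le> real N * 1 - 0"
          using c by (intro diff_mono mult_left_mono) auto
        then show ?thesis using True K by (simp add: mult_right_mono)
      next
        case False
        then have "\<bar>Im \<zeta> - \<phi>\<bar> = \<eta> / \<rho>" using cases \<eta> rho by auto
        then have "\<rho> * \<bar>Im \<zeta> - \<phi>\<bar> = \<eta>" using rho by simp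
        then show ?thesis using tan K by simp
      qed
      finally show "norm (G \<zeta>) \<le> K * exp (real N * exp (\<rho> * X))" .
    qed (use x \<eta> rho \<sigma> K in \<open>auto simp: S_def field_simps\<close>)
    then show ?thesis unfolding norm_G by (simp add: exp_minus field_simps)
  qed
  \<comment> \<open>Beyond \<open>X\<close> the estimate contains the factor exp(-d N) with d > 0,
    for every \<open>N\<close>.\<close>
  have zero: "F (Complex x \<phi>) = 0" if "x > X" for x
  proof -
    define d where "d = exp (\<rho> * x) - exp (\<rho> * X)"
    have "d > 0" using that rho by (simp add: d_def)
    then have "((\<lambda>N. K * exp (- (d * real N))) \<longlongrightarrow> 0) sequentially"
      by real_asymp
    moreover have "norm (F (Complex x \<phi>)) \<le> K * exp (- (d * real N))" for N
      using super[of x N] that by (simp add: d_def exp_add[symmetric] mult.assoc algebra_simps)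
    ultimately have "norm (F (Complex x \<phi>)) \<le> 0" by (intro LIMSEQ_le_const) auto
    then show ?thesis by simp
  qed
  \<comment> \<open>A half-line on the bisector has limit points in the strip, so the identity
    theorem spreads the zeros.\<close>
  define U where "U = (\<lambda>x. Complex x \<phi>) ` {X<..}"
  have "connected U" unfolding U_def
    by (intro connected_continuous_image) (auto simp: Complex_eq intro!: continuous_intros)
  moreover have "Complex (X + 1) \<phi> \<in> U" "Complex (X + 2) \<phi> \<in> U" by (auto simp: U_def)
  ultimately have lim: "Complex (X + 1) \<phi> islimpt U" by (intro connected_imp_perfect) auto
  show ?thesis
  proof (rule analytic_continuation[OF hol open_strip _ _ _ lim])
    show "connected strip" using convex_strip by (rule convex_connected)
    show "U \<subseteq> strip" "Complex (X + 1) \<phi> \<in> strip" using X0 in_int by (auto simp: U_def strip_def)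
  qed (use zero w in \<open>auto simp: U_def\<close>)
qed

end

section \<open>The root along the dominant rays\<close>

text \<open>A Cauchy bound: if |w| > 1, dividing the equation by |w|^(m-1) leaves |w| on one side
  and at most the sum of the moduli of \<open>c\<close> and the coefficients on the other.\<close>

lemma norm_root_le:
  fixes w c :: complex and a :: "nat \<Rightarrow> complex"
  assumes m: "m \<ge> 1" and eq: "w ^ m + (\<Sum>j<m. a j * w ^ j) = c"
  shows "norm w \<le> 1 + norm c + (\<Sum>j<m. norm (a j))"
proof (cases "norm w \<le> 1")
  case True
  moreover have "0 \<le> (\<Sum>j<m. norm (a j))" by (simp add: sum_nonneg)
  ultimately show ?thesis using norm_ge_zero[of c] by linarith
next
  case False
  have "norm w * norm w ^ (m - 1) = norm (w ^ m)" 
    using m power_minus_mult[of m "norm w"] by (simp add: norm_power mult.commute)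
  also have "w ^ m = c - (\<Sum>j<m. a j * w ^ j)" using eq by (simp add: algebra_simps)
  also have "norm \<dots> \<le> norm c + (\<Sum>j<m. norm (a j * w ^ j))"
    by (intro order_trans[OF norm_triangle_ineq4] add_left_mono norm_sum)
  also have "\<dots> \<le> norm c * norm w ^ (m - 1) + (\<Sum>j<m. norm (a j) * norm w ^ (m - 1))"
  proof (intro add_mono sum_mono)
    show "norm c \<le> norm c * norm w ^ (m - 1)"
      using False mult_left_mono[of 1 "norm w ^ (m - 1)" "norm c"] by simp
    show "norm (a j * w ^ j) \<le> norm (a j) * norm w ^ (m - 1)" if "j \<in> {..<m}" for j
      unfolding norm_mult norm_power using that False by (intro mult_left_mono power_increasing) auto
  qed
  also have "\<dots> = (norm c + (\<Sum>j<m. norm (a j))) * norm w ^ (m - 1)"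
    by (simp add: sum_distrib_right distrib_right)
  finally have "norm w \<le> norm c + (\<Sum>j<m. norm (a j))"
    by (rule mult_right_le_imp_le) (use False in \<open>intro zero_less_power, linarith\<close>)
  then show ?thesis by simp
qed

context log_sector
begin

text \<open>Where u^m is close to 1, the root of unity near \<open>u\<close> is a continuous
  function with finitely many values, hence constant on the far part of a narrow wedge. Overlapping
  wedges link all directions of the interval, so one \<open>\<epsilon>\<close> serves them
  all.\<close>

lemma dominant_root_of_unity:
  fixes u :: "complex \<Rightarrow> complex" and \<alpha>1 \<beta>1 :: real
  assumes m: "m \<ge> 1" and hol: "u holomorphic_on strip"
    and tame: "tame {} (\<lambda>\<zeta>. norm (u \<zeta> ^ m - 1))"
    and I: "\<alpha>1 < \<beta>1" "{\<alpha>1<..<\<beta>1} \<subseteq> {\<alpha><..<\<beta>}"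
    and decay: "\<And>\<theta>. \<theta> \<in> {\<alpha>1<..<\<beta>1} \<Longrightarrow> \<exists>c>0. ray_le (\<lambda>\<zeta>. norm (u \<zeta> ^ m - 1)) \<theta> (- c)"
  obtains \<epsilon> where "\<epsilon> ^ m = 1"
    "\<And>\<theta>. \<theta> \<in> {\<alpha>1<..<\<beta>1} \<Longrightarrow>
       \<forall>\<^sub>F x in at_top. norm (u (Complex x \<theta>) - \<epsilon>) \<le> 3 * norm (u (Complex x \<theta>) ^ m - 1)"
proof -
  define v where "v = (\<lambda>\<zeta>. u \<zeta> ^ m - 1)"
  have v_hol: "v holomorphic_on strip" unfolding v_def by (intro holomorphic_intros hol)
  have v_tame: "tame {} (\<lambda>\<zeta>. norm (v \<zeta>))" using tame by (simp add: v_def)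
  \<comment> \<open>Dividing by the principal \<open>m\<close>-th root of \<open>u ^ m\<close> leaves a continuous function with values in the
    finite set of roots of unity.\<close>
  define \<omega> where "\<omega> = (\<lambda>\<zeta>. u \<zeta> * exp (- Ln (1 + v \<zeta>) / of_nat m))"
  \<comment> \<open>The threshold 1 / 4 keeps \<open>1 + v \<zeta>\<close> off the branch cut and
    its logarithm below 1 / 2 in modulus, within reach of the linear estimates used next.\<close>
  have nonpos: "1 + v \<zeta> \<notin> \<real>\<^sub>\<le>\<^sub>0" if "norm (v \<zeta>) < 1 / 4" for \<zeta>
  proof -
    have "\<bar>Re (v \<zeta>)\<bar> < 1 / 4" using that abs_Re_le_cmod by (rule le_less_trans[rotated])
    then show ?thesis by (auto simp: complex_nonpos_Reals_iff)
  qed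
  have \<omega>_power: "\<omega> \<zeta> ^ m = 1" if "norm (v \<zeta>) < 1 / 4" for \<zeta>
  proof -
    have "1 + v \<zeta> \<noteq> 0" using nonpos[OF that] by auto
    have "\<omega> \<zeta> ^ m = u \<zeta> ^ m * exp (of_nat m * (- Ln (1 + v \<zeta>) / of_nat m))"
      by (simp only: \<omega>_def power_mult_distrib exp_of_nat_mult)
    also have "of_nat m * (- Ln (1 + v \<zeta>) / of_nat m) = - Ln (1 + v \<zeta>)" using m by simp
    also have "u \<zeta> ^ m = 1 + v \<zeta>" by (simp add: v_def)
    finally show ?thesis using \<open>1 + v \<zeta> \<noteq> 0\<close> by (simp add: exp_minus)
  qed
  \<comment> \<open>The factor 3 is 2 from the logarithm times 3 / 2 from the exponential.\<close>
  have \<omega>_dist: "norm (u \<zeta> - \<omega> \<zeta>) \<le> 3 * norm (v \<zeta>)" if v: "norm (v \<zeta>) < 1 / 4" for \<zeta>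
  proof -
    define l where "l = Ln (1 + v \<zeta>) / of_nat m"
    have "norm l \<le> norm (Ln (1 + v \<zeta>))" using m mult_right_mono[of 1 "real m" "norm (Ln (1 + v \<zeta>))"]
      by (simp add: l_def norm_divide divide_le_eq mult.commute)
    also have "\<dots> \<le> 2 * norm (v \<zeta>)" using v by (intro norm_Ln_le) auto
    finally have l: "norm l \<le> 2 * norm (v \<zeta>)" .
    have "norm (\<omega> \<zeta>) = 1" using power_eq_1_iff[OF \<omega>_power[OF v]] m by simp
    have "u \<zeta> = \<omega> \<zeta> * exp l" by (simp add: \<omega>_def l_def mult.assoc exp_add[symmetric])
    then have "norm (u \<zeta> - \<omega> \<zeta>) = norm (\<omega> \<zeta> * (exp l - 1))" by (simp add: algebra_simps)
    also have "\<dots> = norm (exp l - 1)" using \<open>norm (\<omega> \<zeta>) = 1\<close> by (simp add: norm_mult)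
    also have "\<dots> \<le> 3 / 2 * norm l" using l v by (intro norm_exp_bounds) auto
    finally show ?thesis using l by simp
  qed
  have local_const: "\<exists>X e. e ^ m = 1 \<and> (\<forall>x\<ge>X. \<forall>y\<in>closed_segment \<theta>1 \<theta>2.
        \<omega> (Complex x y) = e \<and> norm (v (Complex x y)) < 1 / 4)"
    if \<theta>: "\<theta>1 \<in> {\<alpha>1<..<\<beta>1}" "\<theta>2 \<in> {\<alpha>1<..<\<beta>1}" "\<rho> * \<bar>\<theta>1 - \<theta>2\<bar> \<le> pi / 4" for \<theta>1 \<theta>2
  proof -
    obtain c1 c2 where c12: "c1 > 0" "c2 > 0" "ray_le (\<lambda>\<zeta>. norm (v \<zeta>)) \<theta>1 (- c1)" "ray_le (\<lambda>\<zeta>. norm (v \<zeta>)) \<theta>2 (- c2)"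
      using decay[OF \<theta>(1)] decay[OF \<theta>(2)] unfolding v_def by blast
    define c where "c = min c1 c2"
    have c: "c > 0" "ray_le (\<lambda>\<zeta>. norm (v \<zeta>)) \<theta>1 (- c)" "ray_le (\<lambda>\<zeta>. norm (v \<zeta>)) \<theta>2 (- c)"
      using c12 by (auto simp: c_def intro: ray_le_mono)
    have \<theta>': "\<theta>1 \<in> {\<alpha><..<\<beta>}" "\<theta>2 \<in> {\<alpha><..<\<beta>}" using \<theta> I by auto
    obtain X where X: "r0 < exp X" "\<And>x y. x \<ge> X \<Longrightarrow> y \<in> closed_segment \<theta>1 \<theta>2 \<Longrightarrow> norm (v (Complex x y)) < 1 / 4"
      by (rule small_between_decaying_rays[OF v_hol v_tame \<theta>' \<theta>(3) c, of "1 / 4"]) auto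
    define R where "R = {\<zeta>. X \<le> Re \<zeta>} \<inter> ({\<zeta>. min \<theta>1 \<theta>2 \<le> Im \<zeta>} \<inter> {\<zeta>. Im \<zeta> \<le> max \<theta>1 \<theta>2})"
    have R: "Complex x y \<in> R \<longleftrightarrow> x \<ge> X \<and> y \<in> closed_segment \<theta>1 \<theta>2" for x y
      by (auto simp: R_def closed_segment_eq_real_ivl)
    have small: "norm (v \<zeta>) < 1 / 4" if "\<zeta> \<in> R" for \<zeta>
      using that X(2) by (cases \<zeta>) (auto simp: R)
    have "R \<subseteq> strip" 
    proof
      fix \<zeta> assume "\<zeta> \<in> R"
      moreover have "r0 < exp (Re \<zeta>)"
        using X(1) by (rule order.strict_trans2) (use \<open>\<zeta> \<in> R\<close> in \<open>simp add: R_def\<close>)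
      ultimately show "\<zeta> \<in> strip" using X(1) \<theta>' by (auto simp: R_def strip_def min_def max_def split: if_splits)
    qed
    have "connected R" unfolding R_def
      by (intro convex_connected convex_Int) (simp_all add: convex_halfspace_Re_ge convex_halfspace_Im_ge convex_halfspace_Im_le)
    moreover have "continuous_on R \<omega>"
      unfolding \<omega>_def using \<open>R \<subseteq> strip\<close> small nonpos m
      by (intro continuous_intros continuous_on_subset[OF holomorphic_on_imp_continuous_on[OF hol]]
            continuous_on_subset[OF holomorphic_on_imp_continuous_on[OF v_hol]]) auto
    moreover have "finite (\<omega> ` R)"
      using finite_roots_unity[of m, where 'a = complex] m small \<omega>_power by (auto elim!: finite_subset[rotated])
    ultimately have "\<omega> constant_on R" by (rule continuous_finite_range_constant)
    then obtain e where e: "\<And>\<zeta>. \<zeta> \<in> R \<Longrightarrow> \<omega> \<zeta> = e" by (auto simp: constant_on_def)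
    have "Complex X \<theta>1 \<in> R" by (simp add: R)
    then have "e ^ m = 1" using e small \<omega>_power by metis
    then show ?thesis using e small R by blast
  qed
  define \<theta>0 where "\<theta>0 = (\<alpha>1 + \<beta>1) / 2"
  have \<theta>0: "\<theta>0 \<in> {\<alpha>1<..<\<beta>1}" using I by (simp add: \<theta>0_def)
  obtain X e where e: "e ^ m = 1" "\<And>x. x \<ge> X \<Longrightarrow> \<omega> (Complex x \<theta>0) = e"
    using local_const[OF \<theta>0 \<theta>0] by auto
  \<comment> \<open>The radius from which \<open>\<omega>\<close> is constant depends on the
    directions, so only an eventual statement is propagated through the connected interval.\<close>
  have ev: "\<forall>\<^sub>F x in at_top. \<omega> (Complex x \<theta>) = e" if \<theta>: "\<theta> \<in> {\<alpha>1<..<\<beta>1}" for \<theta>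
  proof (rule connected_induction_simple[of "{\<alpha>1<..<\<beta>1}" \<theta>0 \<theta> "\<lambda>\<theta>. \<forall>\<^sub>F x in at_top. \<omega> (Complex x \<theta>) = e"])
    show "\<forall>\<^sub>F x in at_top. \<omega> (Complex x \<theta>0) = e" using eventually_ge_at_top[of X] by eventually_elim (rule e)
  next
    fix t assume t: "t \<in> {\<alpha>1<..<\<beta>1}"
    \<comment> \<open>Two directions in a ball of this radius are at most pi / (4 \<rho>) apart, as
      \<open>local_const\<close> requires.\<close>
    let ?T = "{\<alpha>1<..<\<beta>1} \<inter> ball t (pi / (8 * \<rho>))"
    have "\<forall>\<^sub>F x in at_top. \<omega> (Complex x \<theta>2) = e" if \<theta>12: "\<theta>1 \<in> ?T" "\<theta>2 \<in> ?T" and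
      1: "\<forall>\<^sub>F x in at_top. \<omega> (Complex x \<theta>1) = e" for \<theta>1 \<theta>2
    proof -
      have "\<bar>\<theta>1 - \<theta>2\<bar> \<le> pi / (8 * \<rho>) + pi / (8 * \<rho>)" using \<theta>12 by (auto simp: dist_real_def)
      then have "\<rho> * \<bar>\<theta>1 - \<theta>2\<bar> \<le> pi / 4" using rho by (simp add: field_simps)
      then obtain X' e' where *: "\<forall>x\<ge>X'. \<forall>y\<in>closed_segment \<theta>1 \<theta>2. \<omega> (Complex x y) = e'"
        using local_const[of \<theta>1 \<theta>2] \<theta>12 by auto
      \<comment> \<open>The constant of the wedge and \<open>e\<close> agree because both are
        attained at a common point of the ray \<open>\<theta>1\<close>.\<close>
      have "\<forall>\<^sub>F x in at_top. \<omega> (Complex x \<theta>1) = e \<and> x \<ge> X'"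
        using 1 eventually_ge_at_top by (rule eventually_conj)
      then obtain x where "\<omega> (Complex x \<theta>1) = e" "x \<ge> X'" using eventually_happens by fastforce
      then have "e' = e" using * by auto
      show ?thesis using eventually_ge_at_top[of X'] by eventually_elim (use * \<open>e' = e\<close> in auto)
    qed
    moreover have "openin (top_of_set {\<alpha>1<..<\<beta>1}) ?T" by (intro openin_open_Int) auto
    moreover have "t \<in> ?T" using t rho by auto
    ultimately show "\<exists>T. openin (top_of_set {\<alpha>1<..<\<beta>1}) T \<and> t \<in> T \<and>
        (\<forall>x\<in>T. \<forall>y\<in>T. (\<forall>\<^sub>F xa in at_top. \<omega> (Complex xa x) = e) \<longrightarrow> (\<forall>\<^sub>F x in at_top. \<omega> (Complex x y) = e))"
      by blast
  qed (use \<theta> \<theta>0 in auto)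
  show ?thesis
  proof (rule that[OF e(1)])
    fix \<theta> assume \<theta>: "\<theta> \<in> {\<alpha>1<..<\<beta>1}"
    then obtain X' where "\<forall>x\<ge>X'. norm (v (Complex x \<theta>)) < 1 / 4" using local_const[OF \<theta> \<theta>] by auto
    then have "\<forall>\<^sub>F x in at_top. norm (v (Complex x \<theta>)) < 1 / 4" by (auto simp: eventually_at_top_linorder)
    with ev[OF \<theta>] show "\<forall>\<^sub>F x in at_top. norm (u (Complex x \<theta>) - e) \<le> 3 * norm (u (Complex x \<theta>) ^ m - 1)"
      by eventually_elim (use \<omega>_dist in \<open>auto simp: v_def\<close>)
  qed
qed

text \<open>Outside the interval, \<open>F\<close> and the root \<open>E\<close> of the exponential
  are tame separately. Inside, \<open>F / E\<close> differs from \<open>\<epsilon>\<close> by at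
  most a constant times B / |E|, and multiplication by |E| leaves a multiple of the tame function
  \<open>B\<close>: the exponential growth cancels.\<close>

lemma root_minus_exponential_tame:
  fixes F \<phi> :: "complex \<Rightarrow> complex" and A :: "nat \<Rightarrow> complex \<Rightarrow> complex" and \<alpha>1 \<beta>1 :: real
  assumes m: "m \<ge> 1" and hol: "F holomorphic_on strip" "\<phi> holomorphic_on strip"
    and A: "\<And>j. j < m \<Longrightarrow> tame UNIV (\<lambda>\<zeta>. norm (A j \<zeta>))"
    and eq: "\<And>\<zeta>. \<zeta> \<in> strip \<Longrightarrow> F \<zeta> ^ m + (\<Sum>j<m. A j \<zeta> * F \<zeta> ^ j) = exp (\<phi> \<zeta>)"
    and I: "\<alpha>1 < \<beta>1" "{\<alpha>1<..<\<beta>1} \<subseteq> {\<alpha><..<\<beta>}"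
    and tame_exp: "tame (- {\<alpha>1<..<\<beta>1}) (\<lambda>\<zeta>. norm (exp (\<phi> \<zeta>)))" "tame {} (\<lambda>\<zeta>. norm (exp (- \<phi> \<zeta>)))"
    and decay: "\<And>\<theta>. \<theta> \<in> {\<alpha>1<..<\<beta>1} \<Longrightarrow> \<exists>c>0. ray_le (\<lambda>\<zeta>. norm (exp (- \<phi> \<zeta>))) \<theta> (- c)"
  obtains \<epsilon> where "\<epsilon> ^ m = 1" "tame UNIV (\<lambda>\<zeta>. norm (F \<zeta> - \<epsilon> * exp (\<phi> \<zeta> / of_nat m)))"
proof -
  define E where "E = (\<lambda>\<zeta>. exp (\<phi> \<zeta> / of_nat m))"
  have E_power: "E \<zeta> ^ m = exp (\<phi> \<zeta>)" for \<zeta>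
    using m by (simp add: E_def exp_of_nat_mult[symmetric])
  have E0: "E \<zeta> \<noteq> 0" for \<zeta> by (simp add: E_def)
  define B where "B = (\<lambda>\<zeta>. \<Sum>j<m. norm (A j \<zeta>))"
  have B: "tame UNIV B" unfolding B_def by (intro tame_sum A) auto
  have B0: "B \<zeta> \<ge> 0" for \<zeta> by (simp add: B_def sum_nonneg)
  have tame_sub: "tame \<Theta> g" if "tame \<Theta>' g" "\<Theta> \<subseteq> \<Theta>'" for \<Theta> \<Theta>' g using that by (auto simp: tame_def)
  have F_tame: "tame (- {\<alpha>1<..<\<beta>1}) (\<lambda>\<zeta>. norm (F \<zeta>))"
  proof (rule tame_mono)
    show "tame (- {\<alpha>1<..<\<beta>1}) (\<lambda>\<zeta>. 1 + norm (exp (\<phi> \<zeta>)) + B \<zeta>)"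
      by (intro tame_add tame_const tame_exp tame_sub[OF B]) auto
    show "norm (F \<zeta>) \<le> 1 + norm (exp (\<phi> \<zeta>)) + B \<zeta>" if "\<zeta> \<in> strip" for \<zeta>
      unfolding B_def by (rule norm_root_le[OF m eq[OF that]])
  qed
  define u where "u = (\<lambda>\<zeta>. F \<zeta> / E \<zeta>)"
  have u_hol: "u holomorphic_on strip" unfolding u_def E_def using m by (intro holomorphic_intros hol) auto
  \<comment> \<open>No directions are claimed: comparison between rays needs only the overall
    growth.\<close>
  have u_tame: "tame {} (\<lambda>\<zeta>. norm (u \<zeta> ^ m - 1))"
  proof (rule tame_mono)
    show "tame {} (\<lambda>\<zeta>. norm (F \<zeta>) ^ m * norm (exp (- \<phi> \<zeta>)) + 1)"
      by (intro tame_add tame_const tame_exp tame_mult tame_power tame_sub[OF F_tame]) auto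
    fix \<zeta>
    have "u \<zeta> ^ m = F \<zeta> ^ m * exp (- \<phi> \<zeta>)"
      by (simp add: u_def power_divide E_power exp_minus) (simp add: divide_inverse)
    then show "norm (u \<zeta> ^ m - 1) \<le> norm (F \<zeta>) ^ m * norm (exp (- \<phi> \<zeta>)) + 1"
      using norm_triangle_ineq4[of "u \<zeta> ^ m" 1] by (simp add: norm_mult norm_power)
  qed
  have u_small: "\<exists>c>0. ray_le (\<lambda>\<zeta>. inverse (norm (E \<zeta>))) \<theta> (- c) \<and>
      (\<forall>\<^sub>F x in at_top. norm (u (Complex x \<theta>) ^ m - 1) \<le> 3 ^ m * (B (Complex x \<theta>) / norm (E (Complex x \<theta>))))"
    if \<theta>: "\<theta> \<in> {\<alpha>1<..<\<beta>1}" for \<theta>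
  proof -
    obtain c where c: "c > 0" "ray_le (\<lambda>\<zeta>. norm (exp (- \<phi> \<zeta>))) \<theta> (- c)" using decay[OF \<theta>] by blast
    \<comment> \<open>The rate drops by the factor \<open>m\<close> because \<open>E\<close> is an
      m-th root of exp \<phi>.\<close>
    define d where "d = c / m"
    have d: "d > 0" using c m by (simp add: d_def)
    have E: "ray_le (\<lambda>\<zeta>. inverse (norm (E \<zeta>))) \<theta> (- d)"
      using c(2) unfolding ray_le_def
    proof eventually_elim
      case (elim x)
      have "inverse (norm (E (Complex x \<theta>))) ^ m = norm (exp (- \<phi> (Complex x \<theta>)))"
        by (simp add: power_inverse norm_power[symmetric] E_power exp_minus norm_inverse del: norm_exp_eq_Re)
      also have "\<dots> \<le> exp (- c * exp (\<rho> * x))" by (rule elim)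
      also have "\<dots> = exp (- d * exp (\<rho> * x)) ^ m"
        using m by (simp add: d_def exp_of_nat_mult[symmetric])
      finally show ?case using m by (subst (asm) power_mono_iff) auto
    qed
    have "ray_le B \<theta> d" using tame_ray[OF B UNIV_I _ d] \<theta> I by blast
    moreover have "\<forall>\<^sub>F x in at_top. Complex x \<theta> \<in> strip" using ev_strip \<theta> I by blast
    ultimately have "\<forall>\<^sub>F x in at_top. norm (u (Complex x \<theta>) ^ m - 1) \<le> 3 ^ m * (B (Complex x \<theta>) / norm (E (Complex x \<theta>)))"
      using E unfolding ray_le_def
    proof eventually_elim
      case (elim x)
      define \<zeta> where "\<zeta> = Complex x \<theta>"
      have inv: "inverse (norm (E \<zeta>)) \<le> exp (- d * exp (\<rho> * x))" using elim by (simp add: \<zeta>_def)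
      also have "\<dots> \<le> 1" using d by simp
      finally have inv1: "inverse (norm (E \<zeta>)) \<le> 1" .
      have "B \<zeta> * inverse (norm (E \<zeta>)) \<le> exp (d * exp (\<rho> * x)) * exp (- d * exp (\<rho> * x))"
        using elim(1) inv by (intro mult_mono) (auto simp: \<zeta>_def)
      then have BE: "B \<zeta> / norm (E \<zeta>) \<le> 1" by (simp add: exp_add[symmetric] divide_inverse)
      \<comment> \<open>The coefficients of the equation for \<open>u\<close>. As j < m, each
        carries a factor 1 / E, and further such factors have modulus at most 1 here.\<close>
      define a where "a = (\<lambda>j. A j \<zeta> * E \<zeta> ^ j / E \<zeta> ^ m)"
      have a: "norm (a j) \<le> norm (A j \<zeta>) / norm (E \<zeta>)" if "j < m" for j
      proof -
        have "E \<zeta> ^ m = E \<zeta> ^ j * E \<zeta> ^ (m - j)" using that by (simp add: power_add[symmetric])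
        then have "a j = A j \<zeta> * inverse (E \<zeta>) ^ (m - j)"
          using E0[of \<zeta>] by (simp add: a_def field_simps)
        then have "norm (a j) = norm (A j \<zeta>) * inverse (norm (E \<zeta>)) ^ (m - j)"
          by (simp add: norm_mult norm_power norm_inverse)
        also have "\<dots> \<le> norm (A j \<zeta>) * inverse (norm (E \<zeta>)) ^ 1"
          using that inv1 by (intro mult_left_mono power_decreasing) auto
        finally show ?thesis by (simp add: divide_inverse)
      qed
      have suma: "(\<Sum>j<m. norm (a j)) \<le> B \<zeta> / norm (E \<zeta>)"
        unfolding B_def sum_divide_distrib by (intro sum_mono a) auto
      have "a j * u \<zeta> ^ j = A j \<zeta> * F \<zeta> ^ j / E \<zeta> ^ m" for j
        using E0[of \<zeta>] by (simp add: a_def u_def power_divide)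
      then have "u \<zeta> ^ m + (\<Sum>j<m. a j * u \<zeta> ^ j) = (F \<zeta> ^ m + (\<Sum>j<m. A j \<zeta> * F \<zeta> ^ j)) / E \<zeta> ^ m"
        by (simp add: u_def power_divide sum_divide_distrib add_divide_distrib)
      also have "\<dots> = 1" using eq[of \<zeta>] elim by (simp add: E_power \<zeta>_def)
      finally have ueq: "u \<zeta> ^ m + (\<Sum>j<m. a j * u \<zeta> ^ j) = 1" .
      \<comment> \<open>The root bound reads 1 + 1 + 1: the right-hand side of \<open>ueq\<close> is
        1 and the coefficients sum to at most 1 in modulus.\<close>
      have u3: "norm (u \<zeta>) \<le> 3" using norm_root_le[OF m ueq] suma BE by simp
      have "u \<zeta> ^ m - 1 = - (\<Sum>j<m. a j * u \<zeta> ^ j)" using ueq by (simp add: algebra_simps add_eq_0_iff)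
      then have "norm (u \<zeta> ^ m - 1) = norm (\<Sum>j<m. a j * u \<zeta> ^ j)" by simp
      also have "\<dots> \<le> (\<Sum>j<m. norm (a j * u \<zeta> ^ j))" by (rule norm_sum)
      also have "\<dots> \<le> (\<Sum>j<m. norm (a j) * 3 ^ m)"
      proof (intro sum_mono)
        fix j assume "j \<in> {..<m}"
        then have "norm (u \<zeta>) ^ j \<le> 3 ^ m" using u3 by (meson lessThan_iff less_imp_le norm_ge_zero one_le_numeral order_trans power_increasing power_mono)
        then show "norm (a j * u \<zeta> ^ j) \<le> norm (a j) * 3 ^ m" by (simp add: norm_mult norm_power mult_left_mono)
      qed
      also have "\<dots> \<le> 3 ^ m * (B \<zeta> / norm (E \<zeta>))" 
        using mult_left_mono[OF suma, of "3 ^ m"] by (simp add: sum_distrib_right[symmetric] mult.commute)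
      finally show ?case by (simp add: \<zeta>_def)
    qed
    then show ?thesis using E d by blast
  qed
  have u_decay: "\<exists>c>0. ray_le (\<lambda>\<zeta>. norm (u \<zeta> ^ m - 1)) \<theta> (- c)" if \<theta>: "\<theta> \<in> {\<alpha>1<..<\<beta>1}" for \<theta>
  proof -
    obtain c where c: "c > 0" "ray_le (\<lambda>\<zeta>. inverse (norm (E \<zeta>))) \<theta> (- c)"
      "\<forall>\<^sub>F x in at_top. norm (u (Complex x \<theta>) ^ m - 1) \<le> 3 ^ m * (B (Complex x \<theta>) / norm (E (Complex x \<theta>)))"
      using u_small[OF \<theta>] by blast
    have \<theta>': "\<theta> \<in> {\<alpha><..<\<beta>}" using \<theta> I by blast
    \<comment> \<open>Half of the rate \<open>c\<close> pays for the growth of \<open>B\<close>, a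
      further quarter for the factor \<open>3 ^ m\<close>.\<close>
    have "ray_le B \<theta> (c / 2)" using tame_ray[OF B UNIV_I \<theta>'] c by simp
    then have "\<forall>\<^sub>F x in at_top. Complex x \<theta> \<in> strip \<longrightarrow> norm (u (Complex x \<theta>) ^ m - 1) \<le> 3 ^ m * exp (- (c / 2) * exp (\<rho> * x))"
      using c(2,3) unfolding ray_le_def
    proof eventually_elim
      case (elim x)
      have "B (Complex x \<theta>) * inverse (norm (E (Complex x \<theta>))) \<le> exp (c / 2 * exp (\<rho> * x)) * exp (- c * exp (\<rho> * x))"
        using elim by (intro mult_mono) auto
      also have "\<dots> = exp (- (c / 2) * exp (\<rho> * x))" by (simp add: exp_add[symmetric] field_simps)
      finally have "B (Complex x \<theta>) / norm (E (Complex x \<theta>)) \<le> exp (- (c / 2) * exp (\<rho> * x))"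
        by (simp only: divide_inverse)
      then have "3 ^ m * (B (Complex x \<theta>) / norm (E (Complex x \<theta>))) \<le> 3 ^ m * exp (- (c / 2) * exp (\<rho> * x))"
        by (rule mult_left_mono) simp
      then show ?case using elim by simp
    qed
    then have "ray_le (\<lambda>\<zeta>. norm (u \<zeta> ^ m - 1)) \<theta> (- (c / 4))"
      by (rule ray_leI[OF \<theta>', rotated]) (use c in auto)
    then show ?thesis using c by (intro exI[of _ "c / 4"]) auto
  qed
  obtain \<epsilon> where \<epsilon>: "\<epsilon> ^ m = 1" "\<And>\<theta>. \<theta> \<in> {\<alpha>1<..<\<beta>1} \<Longrightarrow>
       \<forall>\<^sub>F x in at_top. norm (u (Complex x \<theta>) - \<epsilon>) \<le> 3 * norm (u (Complex x \<theta>) ^ m - 1)"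
    by (rule dominant_root_of_unity[OF m u_hol u_tame I u_decay]) blast+
  have norm_\<epsilon>: "norm \<epsilon> = 1" using power_eq_1_iff[OF \<epsilon>(1)] m by simp
  have out: "tame (- {\<alpha>1<..<\<beta>1}) (\<lambda>\<zeta>. norm (F \<zeta> - \<epsilon> * E \<zeta>))"
  proof (rule tame_mono)
    show "tame (- {\<alpha>1<..<\<beta>1}) (\<lambda>\<zeta>. norm (F \<zeta>) + (1 + norm (exp (\<phi> \<zeta>))))"
      by (intro tame_add tame_const F_tame tame_exp)
    fix \<zeta>
    \<comment> \<open>\<open>tame_exp\<close> speaks of exp \<phi> = E^m, so \<open>E\<close> is
      bounded through its power.\<close>
    have "norm (E \<zeta>) \<le> 1 + norm (E \<zeta>) ^ m"
    proof (cases "norm (E \<zeta>) \<le> 1")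
      case False
      then have "norm (E \<zeta>) ^ 1 \<le> norm (E \<zeta>) ^ m" using m by (intro power_increasing) auto
      then show ?thesis by simp
    qed (use zero_le_power[OF norm_ge_zero, of "E \<zeta>" m] in linarith)
    then have "norm (E \<zeta>) \<le> 1 + norm (exp (\<phi> \<zeta>))" by (metis norm_power E_power)
    then show "norm (F \<zeta> - \<epsilon> * E \<zeta>) \<le> norm (F \<zeta>) + (1 + norm (exp (\<phi> \<zeta>)))"
      using norm_triangle_ineq4[of "F \<zeta>" "\<epsilon> * E \<zeta>"] norm_\<epsilon> by (simp add: norm_mult)
  qed
  have inside: "ray_le (\<lambda>\<zeta>. norm (F \<zeta> - \<epsilon> * E \<zeta>)) \<theta> \<delta>" if \<theta>: "\<theta> \<in> {\<alpha>1<..<\<beta>1}" and "\<delta> > 0" for \<theta> \<delta>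
  proof -
    have \<theta>': "\<theta> \<in> {\<alpha><..<\<beta>}" using \<theta> I by blast
    have "ray_le B \<theta> (\<delta> / 2)" using tame_ray[OF B UNIV_I \<theta>'] \<open>\<delta> > 0\<close> by simp
    moreover have "\<forall>\<^sub>F x in at_top. norm (u (Complex x \<theta>) ^ m - 1) \<le> 3 ^ m * (B (Complex x \<theta>) / norm (E (Complex x \<theta>)))"
      using u_small[OF \<theta>] by blast
    ultimately have "\<forall>\<^sub>F x in at_top. Complex x \<theta> \<in> strip \<longrightarrow> norm (F (Complex x \<theta>) - \<epsilon> * E (Complex x \<theta>)) \<le> 3 * 3 ^ m * exp (\<delta> / 2 * exp (\<rho> * x))"
      using \<epsilon>(2)[OF \<theta>] unfolding ray_le_def
    proof eventually_elim
      case (elim x)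
      define \<zeta> where "\<zeta> = Complex x \<theta>"
      have "F \<zeta> - \<epsilon> * E \<zeta> = (u \<zeta> - \<epsilon>) * E \<zeta>" using E0[of \<zeta>] by (simp add: u_def field_simps)
      then have "norm (F \<zeta> - \<epsilon> * E \<zeta>) = norm (u \<zeta> - \<epsilon>) * norm (E \<zeta>)" by (simp add: norm_mult)
      also have "\<dots> \<le> 3 * (3 ^ m * (B \<zeta> / norm (E \<zeta>))) * norm (E \<zeta>)"
        using elim by (intro mult_right_mono) (auto simp: \<zeta>_def)
      also have "\<dots> = 3 * 3 ^ m * B \<zeta>" using E0[of \<zeta>] by simp
      also have "\<dots> \<le> 3 * 3 ^ m * exp (\<delta> / 2 * exp (\<rho> * x))" using elim by (intro mult_left_mono) (auto simp: \<zeta>_def)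
      finally show ?case by (simp add: \<zeta>_def)
    qed
    then show ?thesis by (rule ray_leI[OF \<theta>', rotated]) (use \<open>\<delta> > 0\<close> in auto)
  qed
  have "tame UNIV (\<lambda>\<zeta>. norm (F \<zeta> - \<epsilon> * E \<zeta>))"
    using out inside unfolding tame_def by blast
  then show ?thesis using that \<epsilon>(1) by (simp add: E_def)
qed

end

section \<open>Polynomials over the ring of functions\<close>

lemma power_fun_apply: "((f :: 'a \<Rightarrow> 'b :: comm_semiring_1) ^ n) x = f x ^ n"
  by (induction n) auto

lemma sum_fun_apply: "(sum g A :: 'a \<Rightarrow> 'b :: comm_monoid_add) x = (\<Sum>i\<in>A. g i x)"
  by (induction A rule: infinite_finite_induct) auto

lemma poly_fun_apply:
  fixes P :: "('a \<Rightarrow> 'b :: comm_semiring_1) poly"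
  shows "poly P f x = (\<Sum>j\<le>degree P. coeff P j x * f x ^ j)"
  by (simp add: poly_altdef sum_fun_apply power_fun_apply)

text \<open>Horner's scheme only adds and multiplies by \<open>h\<close>. With closure under just
  these operations, the lemma covers both the ring \<open>slow\<close> and the ideal of functions
  vanishing at a given point.\<close>

lemma coeff_pcompose_shift_mem:
  fixes P :: "'a :: comm_ring_1 poly"
  assumes "0 \<in> K" "\<And>a b. a \<in> K \<Longrightarrow> b \<in> K \<Longrightarrow> a + b \<in> K" "\<And>a. a \<in> K \<Longrightarrow> h * a \<in> K"
    and "\<And>i. coeff P i \<in> K"
  shows "coeff (pcompose P [:h, 1:]) i \<in> K"
  using assms(4)
proof (induction P arbitrary: i)
  case (pCons a P)
  have "a \<in> K" "\<And>i. coeff P i \<in> K"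
    using pCons.prems[of 0] pCons.prems[of "Suc i" for i] by auto
  then have "\<And>i. coeff (pcompose P [:h, 1:]) i \<in> K" by (intro pCons.IH)
  then show ?case using \<open>a \<in> K\<close>
    by (auto simp: pcompose_pCons coeff_pCons assms(1) simp del: coeff_pcompose_0 intro!: assms(2,3) split: nat.splits)
qed (use assms(1) in simp)

lemma pcompose_monom_1: "pcompose (monom 1 n) q = q ^ n"
  by (induction n) (auto simp: monom_Suc monom_0 pcompose_pCons one_pCons)

section \<open>Passage from the sector to the strip\<close>

context log_sector
begin

text \<open>The constant \<open>C\<close> moves into the exponent by C \<le> exp |C|. Order says
  nothing about indicators, hence the empty set of directions.\<close>

lemma tame_of_order_at_most:
  assumes "order_at_most (sector \<alpha> \<beta> r0) \<rho> f"
  shows "tame {} (\<lambda>\<zeta>. norm (f (exp \<zeta>)))"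
  unfolding tame_def
proof (intro conjI allI impI)
  fix \<sigma> assume "\<sigma> > \<rho>"
  then obtain C where C: "\<And>z. z \<in> sector \<alpha> \<beta> r0 \<Longrightarrow> norm (f z) \<le> C * exp (norm z powr \<sigma>)"
    using assms unfolding order_at_most_def by blast
  have "norm (f (exp \<zeta>)) \<le> exp (max 1 \<bar>C\<bar> * (1 + exp (\<sigma> * Re \<zeta>)))" if "\<zeta> \<in> strip" for \<zeta>
  proof -
    have "exp \<zeta> \<in> sector \<alpha> \<beta> r0" using that exp_strip by blast
    then have "norm (f (exp \<zeta>)) \<le> C * exp (exp (\<sigma> * Re \<zeta>))" using C[of "exp \<zeta>"] by (simp add: powr_def)
    also have "C \<le> exp \<bar>C\<bar>" using exp_ge_add_one_self[of "\<bar>C\<bar>"] by linarith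
    then have "C * exp (exp (\<sigma> * Re \<zeta>)) \<le> exp \<bar>C\<bar> * exp (exp (\<sigma> * Re \<zeta>))" by (intro mult_right_mono) auto
    also have "\<dots> = exp (\<bar>C\<bar> * 1 + 1 * exp (\<sigma> * Re \<zeta>))" by (simp add: exp_add)
    also have "\<dots> \<le> exp (max 1 \<bar>C\<bar> * 1 + max 1 \<bar>C\<bar> * exp (\<sigma> * Re \<zeta>))"
      unfolding exp_le_cancel_iff by (intro add_mono mult_right_mono) auto
    finally show ?thesis by (simp add: distrib_left)
  qed
  then show "\<exists>C. \<forall>\<zeta>\<in>strip. norm (f (exp \<zeta>)) \<le> exp (C * (1 + exp (\<sigma> * Re \<zeta>)))" by blast
qed auto

text \<open>The strict inequality turns the limsup into an eventual bound. At zeros of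
  \<open>f\<close> the logarithm is -infinity, but there the bound is trivial.\<close>

lemma ray_le_of_ray_indicator:
  assumes "ray_indicator \<rho> f \<theta> < ereal k"
  shows "ray_le (\<lambda>\<zeta>. norm (f (exp \<zeta>))) \<theta> k"
proof -
  have "\<forall>\<^sub>F r in at_top. log_norm (f (rcis r \<theta>)) / ereal (r powr \<rho>) < ereal k"
    using assms unfolding ray_indicator_def by (rule Limsup_lessD)
  then have "\<forall>\<^sub>F x in at_top. log_norm (f (rcis (exp x) \<theta>)) / ereal (exp x powr \<rho>) < ereal k"
    using exp_at_top by (rule eventually_compose_filterlim)
  then show ?thesis unfolding ray_le_def
  proof eventually_elim
    case (elim x)
    have eq: "exp (Complex x \<theta>) = rcis (exp x) \<theta>" "exp x powr \<rho> = exp (\<rho> * x)"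
      by (simp_all add: rcis_def exp_eq_polar powr_def)
    show ?case
    proof (cases "f (exp (Complex x \<theta>)) = 0")
      case False
      then have "ln (norm (f (exp (Complex x \<theta>)))) < k * exp (\<rho> * x)"
        using elim by (simp add: log_norm_def eq field_simps)
      then have "exp (ln (norm (f (exp (Complex x \<theta>))))) < exp (k * exp (\<rho> * x))" by simp
      then show ?thesis using False by simp
    qed simp
  qed
qed

text \<open>The ring in which coefficients are manipulated: it will contain \<open>B\<close>, the
  constants and the difference \<open>h\<close>, which is not yet known to agree with an element of
  \<open>B\<close>.\<close>

definition slow :: "(complex \<Rightarrow> complex) set" where
  "slow = {g. (\<lambda>\<zeta>. g (exp \<zeta>)) holomorphic_on strip \<and> tame UNIV (\<lambda>\<zeta>. norm (g (exp \<zeta>)))}"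

lemma holomorphic_exp_strip:
  assumes "g holomorphic_on sector \<alpha> \<beta> r0"
  shows "(\<lambda>\<zeta>. g (exp \<zeta>)) holomorphic_on strip"
proof -
  have "(g \<circ> exp) holomorphic_on strip"
    by (rule holomorphic_on_compose) (use assms exp_strip in \<open>auto intro: holomorphic_intros\<close>)
  then show ?thesis by (simp add: o_def)
qed

lemma sector_algebra_subset_slow: "sector_algebra \<alpha> \<beta> r0 \<rho> \<subseteq> slow"
proof
  fix g assume "g \<in> sector_algebra \<alpha> \<beta> r0 \<rho>"
  then have g: "order_at_most (sector \<alpha> \<beta> r0) \<rho> g" "\<And>\<theta>. \<theta> \<in> {\<alpha><..<\<beta>} \<Longrightarrow> ray_indicator \<rho> g \<theta> \<le> 0"
    by (auto simp: sector_algebra_def)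
  have "ray_le (\<lambda>\<zeta>. norm (g (exp \<zeta>))) \<theta> \<delta>" if "\<theta> \<in> {\<alpha><..<\<beta>}" "\<delta> > 0" for \<theta> \<delta>
    using that by (intro ray_le_of_ray_indicator le_less_trans[OF g(2)]) auto
  then show "g \<in> slow"
    using tame_of_order_at_most[OF g(1)] holomorphic_exp_strip[of g] g(1)
    by (auto simp: slow_def tame_def order_at_most_def)
qed

lemma slow_const: "(\<lambda>_. c) \<in> slow"
  by (simp add: slow_def tame_const)

lemma slow_add: "f \<in> slow \<Longrightarrow> g \<in> slow \<Longrightarrow> f + g \<in> slow"
  unfolding slow_def by (auto intro!: holomorphic_intros intro: tame_mono[OF tame_add norm_triangle_ineq])

lemma slow_mult: "f \<in> slow \<Longrightarrow> g \<in> slow \<Longrightarrow> f * g \<in> slow"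
  unfolding slow_def by (auto intro!: holomorphic_intros tame_mult simp: norm_mult)

lemma slow_uminus: "f \<in> slow \<Longrightarrow> - f \<in> slow"
  unfolding slow_def by (auto intro!: holomorphic_intros)

text \<open>Dividing T(W) = 0 by W^k, with \<open>k\<close> the last index whose coefficient is
  nonzero somewhere on the sector, expresses that coefficient by slow functions times negative
  powers of \<open>W\<close>. It decays on the given ray, so \<open>tame_decaying_eq_0\<close> makes
  it vanish.\<close>

lemma slow_coeffs_vanish:
  fixes T :: "(complex \<Rightarrow> complex) poly" and W :: "complex \<Rightarrow> complex"
  assumes width: "\<beta> - \<alpha> > pi / \<rho>"
    and T: "\<And>j. coeff T j \<in> slow"
    and W: "\<And>z. z \<in> sector \<alpha> \<beta> r0 \<Longrightarrow> W z \<noteq> 0"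
    and root: "\<And>z. z \<in> sector \<alpha> \<beta> r0 \<Longrightarrow> poly T W z = 0"
    and \<theta>: "\<theta> \<in> {\<alpha><..<\<beta>}" and c: "c > 0" "ray_le (\<lambda>\<zeta>. inverse (norm (W (exp \<zeta>)))) \<theta> (- c)"
    and z: "z \<in> sector \<alpha> \<beta> r0"
  shows "coeff T j z = 0"
proof (rule ccontr)
  assume nz: "coeff T j z \<noteq> 0"
  \<comment> \<open>Coefficients that vanish on the sector may be nonzero elsewhere, so the degree
    of \<open>T\<close> cannot serve as top index.\<close>
  define J where "J = {j. \<exists>z\<in>sector \<alpha> \<beta> r0. coeff T j z \<noteq> 0}"
  have J_le: "J \<subseteq> {..degree T}" by (force simp: J_def coeff_eq_0 intro: le_degree)
  then have "finite J" by (rule finite_subset) simp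
  define k where "k = Max J"
  have "j \<in> J" using nz z by (auto simp: J_def)
  then have k: "k \<in> J" unfolding k_def using \<open>finite J\<close> by (intro Max_in) auto
  have above: "coeff T i w = 0" if "i > k" "w \<in> sector \<alpha> \<beta> r0" for i w
  proof (rule ccontr)
    assume "coeff T i w \<noteq> 0"
    then have "i \<in> J" using that by (auto simp: J_def)
    then have "i \<le> k" unfolding k_def using \<open>finite J\<close> by simp
    then show False using that by simp
  qed
  define g where "g = (\<lambda>\<zeta>. \<Sum>i<k. norm (coeff T i (exp \<zeta>)))"
  have g: "tame UNIV g" unfolding g_def using T by (intro tame_sum) (auto simp: slow_def)
  have bound: "norm (coeff T k w) \<le> (\<Sum>i<k. norm (coeff T i w)) * inverse (norm (W w))"
    if w: "w \<in> sector \<alpha> \<beta> r0" and W1: "inverse (norm (W w)) \<le> 1" for w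
  proof -
    have "0 = (\<Sum>i\<le>degree T. coeff T i w * W w ^ i)" using root[OF w] by (simp add: poly_fun_apply)
    also have "\<dots> = (\<Sum>i\<le>k. coeff T i w * W w ^ i)"
      using k J_le above[OF _ w] by (intro sum.mono_neutral_right) auto
    also have "{..k} = insert k {..<k}" by auto
    also have "(\<Sum>i\<in>\<dots>. coeff T i w * W w ^ i) = coeff T k w * W w ^ k + (\<Sum>i<k. coeff T i w * W w ^ i)"
      by (subst sum.insert) auto
    finally have "coeff T k w * W w ^ k = - (\<Sum>i<k. coeff T i w * W w ^ i)" by (simp add: add_eq_0_iff)
    then have "coeff T k w = - (\<Sum>i<k. coeff T i w * W w ^ i) / W w ^ k"
      using W[OF w] by (simp add: field_simps)
    also have "\<dots> = - (\<Sum>i<k. coeff T i w * inverse (W w) ^ (k - i))"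
    proof -
      have "coeff T i w * W w ^ i / W w ^ k = coeff T i w * inverse (W w) ^ (k - i)" if "i < k" for i
      proof -
        have "W w ^ k = W w ^ i * W w ^ (k - i)" using that by (simp add: power_add[symmetric])
        then show ?thesis using W[OF w] by (simp add: field_simps)
      qed
      then show ?thesis by (simp add: sum_divide_distrib)
    qed
    finally have "norm (coeff T k w) = norm (\<Sum>i<k. coeff T i w * inverse (W w) ^ (k - i))" by simp
    also have "\<dots> \<le> (\<Sum>i<k. norm (coeff T i w * inverse (W w) ^ (k - i)))" by (rule norm_sum)
    also have "\<dots> \<le> (\<Sum>i<k. norm (coeff T i w) * inverse (norm (W w)))"
    proof (rule sum_mono)
      fix i assume "i \<in> {..<k}"
      then have "inverse (norm (W w)) ^ (k - i) \<le> inverse (norm (W w)) ^ 1" using W1 by (intro power_decreasing) auto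
      then show "norm (coeff T i w * inverse (W w) ^ (k - i)) \<le> norm (coeff T i w) * inverse (norm (W w))"
        unfolding norm_mult norm_power norm_inverse by (intro mult_left_mono) auto
    qed
    finally show ?thesis by (simp add: sum_distrib_right)
  qed
  have "ray_le g \<theta> (c / 2)" using tame_ray[OF g UNIV_I \<theta>] c by simp
  then have "\<forall>\<^sub>F x in at_top. Complex x \<theta> \<in> strip \<longrightarrow>
      norm (coeff T k (exp (Complex x \<theta>))) \<le> 1 * exp (- (c / 2) * exp (\<rho> * x))"
    using c(2) unfolding ray_le_def
  proof eventually_elim
    case (elim x)
    show ?case
    proof
      assume "Complex x \<theta> \<in> strip"
      then have w: "exp (Complex x \<theta>) \<in> sector \<alpha> \<beta> r0" using exp_strip by blast
      have "exp (- c * exp (\<rho> * x)) \<le> 1" using c by simp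
      with elim(2) have "inverse (norm (W (exp (Complex x \<theta>)))) \<le> 1" by (rule order_trans)
      then have "norm (coeff T k (exp (Complex x \<theta>))) \<le> g (Complex x \<theta>) * inverse (norm (W (exp (Complex x \<theta>))))"
        using bound[OF w] by (simp add: g_def)
      also have "\<dots> \<le> exp (c / 2 * exp (\<rho> * x)) * exp (- c * exp (\<rho> * x))"
        using elim by (intro mult_mono) auto
      also have "\<dots> = 1 * exp (- (c / 2) * exp (\<rho> * x))" by (simp add: exp_add[symmetric] field_simps)
      finally show "norm (coeff T k (exp (Complex x \<theta>))) \<le> 1 * exp (- (c / 2) * exp (\<rho> * x))" .
    qed
  qed
  then have ray: "ray_le (\<lambda>\<zeta>. norm (coeff T k (exp \<zeta>))) \<theta> (- (c / 4))"
    using c by (intro ray_leI[OF \<theta>, where g = "\<lambda>\<zeta>. norm (coeff T k (exp \<zeta>))" and k = "- (c / 2)" and K = 1]) auto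
  have "coeff T k w = 0" if w: "w \<in> sector \<alpha> \<beta> r0" for w
  proof -
    obtain \<zeta> where "\<zeta> \<in> strip" "w = exp \<zeta>" using w exp_strip by blast
    have "coeff T k (exp \<zeta>) = 0"
    proof (rule tame_decaying_eq_0[where F = "\<lambda>\<zeta>. coeff T k (exp \<zeta>)" and ?\<theta>1.0 = \<theta> and ?c1.0 = "c / 4"])
      show "(\<lambda>\<zeta>. coeff T k (exp \<zeta>)) holomorphic_on strip" "tame UNIV (\<lambda>\<zeta>. norm (coeff T k (exp \<zeta>)))"
        using T[of k] by (simp_all add: slow_def)
    qed (fact width \<theta> ray \<open>\<zeta> \<in> strip\<close> | use c in simp)+
    then show ?thesis by (simp add: \<open>w = exp \<zeta>\<close>)
  qed
  then show False using k by (auto simp: J_def)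
qed

end

section \<open>Comparison of the shifted polynomial with a pure power\<close>

theorem theorem3p1:
  fixes \<alpha> \<beta> r0 \<rho> :: real
    and B :: "(complex \<Rightarrow> complex) set"
    and p f :: "complex \<Rightarrow> complex"
    and P :: "(complex \<Rightarrow> complex) poly"
    and m :: nat
  assumes "\<rho> > 0" and "r0 \<ge> 0" and "\<beta> - \<alpha> > pi / \<rho>"
    and "subalgebra_of B (sector_algebra \<alpha> \<beta> r0 \<rho>)"
    and "p holomorphic_on sector \<alpha> \<beta> r0"
    and "m \<ge> 1" and "monic_over B m P"
    and "f holomorphic_on sector \<alpha> \<beta> r0"
    and "\<And>z. z \<in> sector \<alpha> \<beta> r0 \<Longrightarrow> poly P f z = exp (p z)"
    and "almost_sinusoidal \<alpha> \<beta> r0 \<rho> p"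
  shows "\<exists>q\<in>B. poly_eq_on (sector \<alpha> \<beta> r0) P ([:q, 1:] ^ m) \<and>
           (\<exists>\<epsilon>::complex. \<epsilon> ^ m = 1 \<and>
              (\<forall>z\<in>sector \<alpha> \<beta> r0. f z = \<epsilon> * exp (p z / of_nat m) - q z))"
proof -
  interpret log_sector \<alpha> \<beta> r0 \<rho> by unfold_locales (use assms in auto)
  note m = assms(6)
  have deg: "degree P = m" and lead: "coeff P m = 1" and low: "\<And>j. j < m \<Longrightarrow> coeff P j \<in> B"
    using assms(7) by (auto simp: monic_over_def)
  have B_slow: "B \<subseteq> slow" using assms(4) sector_algebra_subset_slow by (auto simp: subalgebra_of_def)
  have one_slow: "1 \<in> slow" using slow_const[of 1] by (simp add: one_fun_def)
  have zero_slow: "0 \<in> slow" using slow_const[of 0] by (simp add: zero_fun_def)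
  have P_slow: "coeff P j \<in> slow" for j
    using low[of j] B_slow lead one_slow zero_slow deg by (cases j m rule: linorder_cases) (auto simp: coeff_eq_0)
  have eq: "f z ^ m + (\<Sum>j<m. coeff P j z * f z ^ j) = exp (p z)" if "z \<in> sector \<alpha> \<beta> r0" for z
    using assms(9)[OF that] by (simp add: poly_fun_apply deg lessThan_Suc_atMost[symmetric] lead add.commute)
  obtain \<alpha>1 \<beta>1 where I: "\<alpha>1 < \<beta>1" "{\<alpha>1<..<\<beta>1} \<subseteq> {\<alpha><..<\<beta>}"
    and ind: "\<And>\<theta>. \<theta> \<in> {\<alpha>1<..<\<beta>1} \<Longrightarrow> ray_indicator \<rho> (\<lambda>z. exp (- p z)) \<theta> < 0"
      "\<And>\<theta>. \<theta> \<in> {\<alpha><..<\<beta>} - {\<alpha>1<..<\<beta>1} \<Longrightarrow> ray_indicator \<rho> (\<lambda>z. exp (p z)) \<theta> \<le> 0"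
    and order: "order_at_most (sector \<alpha> \<beta> r0) \<rho> (\<lambda>z. exp (p z))"
      "order_at_most (sector \<alpha> \<beta> r0) \<rho> (\<lambda>z. exp (- p z))"
    using assms(10) unfolding almost_sinusoidal_def by blast
  have decay: "\<exists>c>0. ray_le (\<lambda>\<zeta>. norm (exp (- p (exp \<zeta>)))) \<theta> (- c)" if \<theta>: "\<theta> \<in> {\<alpha>1<..<\<beta>1}" for \<theta>
  proof -
    \<comment> \<open>The indicator may be -infinity; any real \<open>k\<close> strictly between it
      and 0 gives a decay rate.\<close>
    obtain k where "ray_indicator \<rho> (\<lambda>z. exp (- p z)) \<theta> < ereal k" "ereal k < 0"
      using ereal_dense2[OF ind(1)[OF \<theta>]] by blast
    then show ?thesis using ray_le_of_ray_indicator[of "\<lambda>z. exp (- p z)" \<theta> k]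
      by (intro exI[of _ "- k"]) auto
  qed
  have "ray_le (\<lambda>\<zeta>. norm (exp (p (exp \<zeta>)))) \<theta> \<delta>" if "\<theta> \<in> {\<alpha><..<\<beta>} - {\<alpha>1<..<\<beta>1}" "\<delta> > 0" for \<theta> \<delta>
    by (rule ray_le_of_ray_indicator[of "\<lambda>z. exp (p z)"]) (use ind(2)[OF that(1)] that(2) in \<open>auto intro: le_less_trans\<close>)
  then have tame_exp: "tame (- {\<alpha>1<..<\<beta>1}) (\<lambda>\<zeta>. norm (exp (p (exp \<zeta>))))"
    using tame_of_order_at_most[OF order(1)] unfolding tame_def by blast
  obtain \<epsilon> where \<epsilon>: "\<epsilon> ^ m = 1" "tame UNIV (\<lambda>\<zeta>. norm (f (exp \<zeta>) - \<epsilon> * exp (p (exp \<zeta>) / of_nat m)))"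
  proof (rule root_minus_exponential_tame[of m "\<lambda>\<zeta>. f (exp \<zeta>)" "\<lambda>\<zeta>. p (exp \<zeta>)" "\<lambda>j \<zeta>. coeff P j (exp \<zeta>)" \<alpha>1 \<beta>1])
    show "f (exp \<zeta>) ^ m + (\<Sum>j<m. coeff P j (exp \<zeta>) * f (exp \<zeta>) ^ j) = exp (p (exp \<zeta>))" if "\<zeta> \<in> strip" for \<zeta>
      using eq that exp_strip by blast
  qed (use m P_slow I tame_exp tame_of_order_at_most[OF order(2)] decay assms(5,8) in
        \<open>auto intro: holomorphic_exp_strip simp: slow_def\<close>)
  define W where "W = (\<lambda>z. \<epsilon> * exp (p z / of_nat m))"
  define h where "h = f - W"
  have W_power: "W z ^ m = exp (p z)" for z
    using m \<epsilon>(1) by (simp add: W_def power_mult_distrib exp_of_nat_mult[symmetric])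
  have h: "h \<in> slow"
    using \<epsilon>(2) m unfolding slow_def h_def W_def fun_diff_def
    by (auto intro!: holomorphic_intros holomorphic_exp_strip assms)
  \<comment> \<open>\<open>W\<close> is a root of \<open>T\<close> on the sector, since h + W = f
    and P(f) = exp p = W^m.\<close>
  define T where "T = pcompose P [:h, 1:] - monom 1 m"
  have T_slow: "coeff T j \<in> slow" for j
  proof -
    have "coeff (pcompose P [:h, 1:]) j \<in> slow"
      by (intro coeff_pcompose_shift_mem zero_slow slow_add slow_mult h P_slow)
    moreover have "- coeff (monom 1 m) j \<in> slow" by (auto intro: slow_uminus zero_slow one_slow simp: coeff_monom)
    ultimately show ?thesis unfolding T_def coeff_diff by (metis slow_add uminus_add_conv_diff add.commute)
  qed
  have "poly T W z = poly P f z - W z ^ m" for z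
    by (simp add: T_def poly_pcompose h_def poly_monom power_fun_apply)
  then have T_root: "poly T W z = 0" if "z \<in> sector \<alpha> \<beta> r0" for z
    using assms(9)[OF that] W_power by simp
  define \<theta> where "\<theta> = (\<alpha>1 + \<beta>1) / 2"
  have \<theta>: "\<theta> \<in> {\<alpha>1<..<\<beta>1}" using I by (simp add: \<theta>_def)
  obtain c where c: "c > 0" "ray_le (\<lambda>\<zeta>. norm (exp (- p (exp \<zeta>)))) \<theta> (- c)" using decay[OF \<theta>] by blast
  have W_ray: "ray_le (\<lambda>\<zeta>. inverse (norm (W (exp \<zeta>)))) \<theta> (- (c / m))"
    using c(2) unfolding ray_le_def
  proof eventually_elim
    case (elim x)
    have "inverse (norm (W (exp (Complex x \<theta>)))) ^ m = norm (exp (- p (exp (Complex x \<theta>))))"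
      by (simp add: power_inverse norm_power[symmetric] W_power exp_minus norm_inverse del: norm_exp_eq_Re)
    also have "\<dots> \<le> exp (- c * exp (\<rho> * x))" by (rule elim)
    also have "\<dots> = exp (- (c / m) * exp (\<rho> * x)) ^ m" using m by (simp add: exp_of_nat_mult[symmetric])
    finally show ?case using m by (subst (asm) power_mono_iff) auto
  qed
  have W0: "W z \<noteq> 0" for z using \<epsilon>(1) m by (auto simp: W_def power_0_left)
  have T0: "coeff T j z = 0" if "z \<in> sector \<alpha> \<beta> r0" for j z
    by (rule slow_coeffs_vanish[OF assms(3) T_slow W0 T_root _ _ W_ray that]) (use \<theta> I c m in auto)
  \<comment> \<open>Shifting back by -h turns the vanishing of \<open>T\<close> on the sector into
    P(w) = (w - h)^m there.\<close>
  have shift_back: "P - [:- h, 1:] ^ m = pcompose T [:- h, 1:]"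
  proof -
    have "pcompose [:h, 1:] [:- h, 1:] = [:0, 1:]" by (simp add: pcompose_pCons)
    then show ?thesis by (simp add: T_def pcompose_diff pcompose_monom_1 pcompose_assoc[symmetric])
  qed
  have P_eq: "coeff P j z = coeff ([:- h, 1:] ^ m) j z" if "z \<in> sector \<alpha> \<beta> r0" for j z
  proof -
    have "coeff (pcompose T [:- h, 1:]) j \<in> {g. g z = 0}"
      by (rule coeff_pcompose_shift_mem) (auto simp: T0[OF that])
    then have "coeff (P - [:- h, 1:] ^ m) j z = 0" by (simp add: shift_back)
    then show ?thesis by simp
  qed
  \<comment> \<open>The coefficient of w^(m-1) in (w - h)^m is -m h. Membership in \<open>B\<close>
    concerns total functions, so \<open>q\<close> is built from a coefficient of \<open>P\<close>;
    it agrees with -h on the sector only.\<close>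
  define q where "q = (\<lambda>z. (1 / of_nat m) * coeff P (m - 1) z)"
  have "coeff P (m - 1) \<in> B" using low m by simp
  then have "q \<in> B" unfolding q_def using assms(4) unfolding subalgebra_of_def by blast
  have q: "q z = - h z" if "z \<in> sector \<alpha> \<beta> r0" for z
  proof -
    have "m choose (m - 1) = m" using m binomial_symmetric[of "m - 1" m] by simp
    then show ?thesis using m by (simp add: q_def P_eq[OF that] coeff_linear_poly_power)
  qed
  have "coeff P j z = coeff ([:q, 1:] ^ m) j z" if "z \<in> sector \<alpha> \<beta> r0" for j z
  proof (cases "j \<le> m")
    case True
    then show ?thesis by (simp add: P_eq[OF that] coeff_linear_poly_power power_fun_apply q[OF that])
  next
    case False
    then have "degree ([:q, 1:] ^ m) < j" "degree P < j" 
      using deg degree_power_le[of "[:q, 1:]" m] by (auto intro: le_less_trans)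
    then show ?thesis by (simp add: coeff_eq_0)
  qed
  then have "poly_eq_on (sector \<alpha> \<beta> r0) P ([:q, 1:] ^ m)" by (simp add: poly_eq_on_def)
  moreover have "f z = \<epsilon> * exp (p z / of_nat m) - q z" if "z \<in> sector \<alpha> \<beta> r0" for z
    by (simp add: q[OF that] h_def W_def)
  ultimately show ?thesis using \<open>q \<in> B\<close> \<epsilon>(1) by blast
qed

end
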